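(* If the oracle's predictions have edit-distance error $\eta_{ed}$, then the competitive ratio of the Predictive Marker algorithm (with switching threshold $\tau=H_k$) is at most $$\min\left(3+2\,\frac{\eta_{ed}}{\mathrm{OPT}},\ 4H_k\right).$$
   Context: Caching problem: a cache holds at most $k$ elements (initially empty); a request sequence $\sigma=z_1,\dots,z_n$ is fixed in advance (oblivious to the algorithm's random choices) and revealed online. A request to an element not in the cache is a cache miss (cost 1); the element is then placed in the cache, evicting some element if the cache is full. $\mathrm{OPT}$ is the minimum number of misses of an offline algorithm on $\sigma$. The competitive ratio of a randomized algorithm is (expected number of misses)/$\mathrm{OPT}$, required to hold for every $\sigma$. Predictions: when $z_i$ arrives the oracle outputs $h_i\in\mathbb{N}^+$, a prediction of $y_i=\min\{\tau>i:z_\tau=z_i\}$ ($y_i=n+1$ if none). $H_k=1+\frac12+\dots+\frac1k$. Edit-distance error: let $(e,i)$ denote the $i$-th request of element $e$ in $\sigma$. Its true arrival time is the position of that request in $\sigma$; its predicted arrival time is the oracle's prediction of the next request time of $e$ made at the $(i-1)$-th request of $e$. Let $A_T$ be the sequence of all such pairs sorted by true arrival time and $B_T$ the sequence of the same pairs sorted by predicted arrival time; $\eta_{ed}$ is the edit distance between $A_T$ and $B_T$. Predictive Marker with switching threshold $\tau$: it stores for each element $z$ the latest prediction $p(z)$ (on arrival of $z_i$, set $p(z_i)\leftarrow h_i$). It runs in phases and maintains a set of marked elements, a set $\mathcal{S}$ and "chains". On request $z_i$: if $z_i$ is in the cache or the cache has fewer than $k$ elements, put $z_i$ in the cache and mark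 it. Otherwise (a miss with full cache): if all $k$ cached elements are marked, start a new phase: let $\mathcal{S}$ be the current cache contents and unmark all elements. Then, if $z_i\notin\mathcal{S}$ ($z_i$ is clean), create a new chain of length $1$ and evict the unmarked cached element $e$ with the largest $p(e)$. If $z_i\in\mathcal{S}$ ($z_i$ is stale), then $z_i$ is the current representative of some chain $c$ of this phase; increase the length $n(c)$ of $c$ by $1$; if $n(c)\le\tau$ evict the unmarked cached element $e$ with the largest $p(e)$, otherwise evict a uniformly random unmarked cached element $e$. In both cases $z_i$ replaces $e$ in the cache, $e$ becomes the representative of the corresponding chain, and $z_i$ is marked. *)

theory Defs
  imports "HOL-Probability.Probability"
begin

text \<open>\<open>offline_run k C zs m\<close>: with cache size \<open>k\<close> and cache contents \<open>C\<close>, the requests \<open>zs\<close>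
  can be served with exactly \<open>m\<close> misses.\<close>

inductive offline_run :: "nat \<Rightarrow> 'a set \<Rightarrow> 'a list \<Rightarrow> nat \<Rightarrow> bool" for k where
  finished: "offline_run k C [] 0"
| hit: "z \<in> C \<Longrightarrow> offline_run k C zs m \<Longrightarrow> offline_run k C (z # zs) m"
| miss_room: "z \<notin> C \<Longrightarrow> card C < k \<Longrightarrow> offline_run k (insert z C) zs m
    \<Longrightarrow> offline_run k C (z # zs) (Suc m)"
| miss_evict: "z \<notin> C \<Longrightarrow> card C = k \<Longrightarrow> e \<in> C \<Longrightarrow> offline_run k (insert z (C - {e})) zs m
    \<Longrightarrow> offline_run k C (z # zs) (Suc m)"

definition OPT :: "nat \<Rightarrow> 'a list \<Rightarrow> nat" where
  "OPT k \<sigma> = (LEAST m. offline_run k {} \<sigma> m)"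

inductive edit_step :: "'b list \<Rightarrow> 'b list \<Rightarrow> bool" where
  ins: "edit_step (us @ vs) (us @ x # vs)"
| del: "edit_step (us @ x # vs) (us @ vs)"
| sub: "edit_step (us @ x # vs) (us @ y # vs)"

definition edit_distance :: "'b list \<Rightarrow> 'b list \<Rightarrow> nat" where
  "edit_distance xs ys = (LEAST d. (edit_step ^^ d) xs ys)"

text \<open>The request at list position \<open>j\<close> (counted from 0) as a pair \<open>(e, i)\<close>, meaning the \<open>i\<close>-th
  request (counted from 1) of element \<open>e\<close>; \<open>request_pos\<close> is the inverse map.\<close>

definition request_at :: "'a list \<Rightarrow> nat \<Rightarrow> 'a \<times> nat" where
  "request_at \<sigma> j = (\<sigma> ! j, count_list (take (Suc j) \<sigma>) (\<sigma> ! j))"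

definition request_pos :: "'a list \<Rightarrow> 'a \<times> nat \<Rightarrow> nat" where
  "request_pos \<sigma> q = (THE j. j < length \<sigma> \<and> request_at \<sigma> j = q)"

definition predicted_time :: "'a list \<Rightarrow> nat list \<Rightarrow> 'a \<times> nat \<Rightarrow> nat" where
  "predicted_time \<sigma> h = (\<lambda>(e, i). h ! request_pos \<sigma> (e, i - 1))"

text \<open>Only pairs with \<open>i \<ge> 2\<close> have a predicted arrival time.\<close>

definition true_order :: "'a list \<Rightarrow> ('a \<times> nat) list" where
  "true_order \<sigma> = filter (\<lambda>(e, i). 2 \<le> i) (map (request_at \<sigma>) [0..<length \<sigma>])"

text \<open>As \<^const>\<open>sort_key\<close> is stable, this sorts by predicted time, and requests of different
  elements with the same predicted time by the order on elements. Ties in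
  \<open>furthest\<close> below are broken by the same order. If the two used unrelated tie-breaking rules, the error would not
  control the algorithm: with constant predictions, \<open>pred_order\<close> could equal \<open>true_order\<close>
  while the evictions are arbitrarily bad.\<close>

definition pred_order :: "'a::linorder list \<Rightarrow> nat list \<Rightarrow> ('a \<times> nat) list" where
  "pred_order \<sigma> h = sort_key (predicted_time \<sigma> h) (sort_key fst (true_order \<sigma>))"

definition eta_ed :: "'a::linorder list \<Rightarrow> nat list \<Rightarrow> nat" where
  "eta_ed \<sigma> h = edit_distance (true_order \<sigma>) (pred_order \<sigma> h)"

text \<open>A chain is a pair of its current representative and its length.\<close>

record 'a pm_state =
  cache :: "'a set"
  marked :: "'a set"
  phase_set :: "'a set"
  chains :: "('a \<times> nat) list"
  latest_pred :: "'a \<Rightarrow> nat"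
  misses :: nat

definition pm_init :: "'a pm_state" where
  "pm_init = \<lparr>cache = {}, marked = {}, phase_set = {}, chains = [],
     latest_pred = (\<lambda>_. 0), misses = 0\<rparr>"

definition new_phase :: "'a pm_state \<Rightarrow> 'a pm_state" where
  "new_phase s = s\<lparr>phase_set := cache s, marked := {}, chains := []\<rparr>"

definition unmarked :: "'a pm_state \<Rightarrow> 'a set" where
  "unmarked s = cache s - marked s"

definition furthest :: "'a::linorder pm_state \<Rightarrow> 'a" where
  "furthest s = Max {e \<in> unmarked s. \<forall>e' \<in> unmarked s. latest_pred s e' \<le> latest_pred s e}"

definition replace :: "'a \<Rightarrow> 'a \<Rightarrow> ('a \<times> nat) list \<Rightarrow> 'a pm_state \<Rightarrow> 'a pm_state" where
  "replace z e cs s = s\<lparr>cache := insert z (cache s - {e}), marked := insert z (marked s),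
     chains := cs, misses := Suc (misses s)\<rparr>"

definition serve_clean :: "'a::linorder \<Rightarrow> 'a pm_state \<Rightarrow> 'a pm_state pmf" where
  "serve_clean z s =
     return_pmf (replace z (furthest s) (chains s @ [(furthest s, 1)]) s)"

definition serve_stale :: "real \<Rightarrow> 'a::linorder \<Rightarrow> 'a pm_state \<Rightarrow> 'a pm_state pmf" where
  "serve_stale \<tau> z s =
     (let c = (THE c. c < length (chains s) \<and> fst (chains s ! c) = z);
          m = Suc (snd (chains s ! c))
      in map_pmf (\<lambda>e. replace z e ((chains s)[c := (e, m)]) s)
           (if real m \<le> \<tau> then return_pmf (furthest s) else pmf_of_set (unmarked s)))"

definition serve_full_miss :: "real \<Rightarrow> 'a::linorder \<Rightarrow> 'a pm_state \<Rightarrow> 'a pm_state pmf" where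
  "serve_full_miss \<tau> z s =
     (let s' = (if cache s \<subseteq> marked s then new_phase s else s)
      in if z \<notin> phase_set s' then serve_clean z s' else serve_stale \<tau> z s')"

definition pm_step ::
  "nat \<Rightarrow> real \<Rightarrow> 'a::linorder \<times> nat \<Rightarrow> 'a pm_state \<Rightarrow> 'a pm_state pmf" where
  "pm_step k \<tau> = (\<lambda>(z, p) s0.
     let s = s0\<lparr>latest_pred := (latest_pred s0)(z := p)\<rparr>
     in if z \<in> cache s then return_pmf (s\<lparr>marked := insert z (marked s)\<rparr>)
        else if card (cache s) < k then
          return_pmf (s\<lparr>cache := insert z (cache s), marked := insert z (marked s),
            misses := Suc (misses s)\<rparr>)
        else serve_full_miss \<tau> z s)"

primrec pm_run ::
  "nat \<Rightarrow> real \<Rightarrow> ('a::linorder \<times> nat) list \<Rightarrow> 'a pm_state \<Rightarrow> 'a pm_state pmf" where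
  "pm_run k \<tau> [] s = return_pmf s"
| "pm_run k \<tau> (r # rs) s = bind_pmf (pm_step k \<tau> r s) (pm_run k \<tau> rs)"

definition pm_expected_misses :: "nat \<Rightarrow> real \<Rightarrow> 'a::linorder list \<Rightarrow> nat list \<Rightarrow> real" where
  "pm_expected_misses k \<tau> \<sigma> h =
     measure_pmf.expectation (pm_run k \<tau> (zip \<sigma> h) pm_init) (\<lambda>s. real (misses s))"

end

theory Submission
  imports Defs "HOL-Library.Sublist"
begin

text \<open>The phases, the marked elements and the clean requests of Predictive Marker depend on the
  request sequence only, and at most \<open>2 * OPT\<close> requests are clean. Both bounds follow from a
  potential that sums over the chains of the current phase.

  When an evicted element \<open>e\<close> returns and a uniformly random one of \<open>u\<close> unmarked elements is evicted
  instead, \<open>u = k -\<close> (number of marked elements) is known in advance, and the numbers \<open>v\<close> of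
  unmarked elements at the returns of these \<open>u\<close> candidates are distinct and smaller than \<open>u\<close>. As
  \<open>H\<^sub>1 + \<dots> + H\<^sub>u\<^sub>-\<^sub>1 = u (H\<^sub>u - 1)\<close>, the value \<open>H\<^sub>v\<close> of a chain drops by one in expectation.
  With at most \<open>H\<^sub>k\<close> misses before the switch, a chain costs at most \<open>2 H\<^sub>k\<close>.

  For the error bound, fix a longest common subsequence of the true and the predicted order and call
  the at most \<open>\<eta>\<close> requests outside of it lost. If an element that was evicted as furthest returns with
  a request that is not lost, then every unmarked element in the cache is next requested by a lost
  request or never again, so that from then on every eviction can be charged to a lost request or to
  an element that never returns. If instead the first \<open>\<lfloor>H\<^sub>k\<rfloor>\<close> evictions of a chain all belong to lost
  requests, these lost requests also pay for the random part, whose expected cost is at most \<open>H\<^sub>k\<close>.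
  An element is charged for never returning at most once, and there are at most \<open>OPT\<close> elements.\<close>

section \<open>Clean requests and OPT\<close>

text \<open>Replays the phases on the requests alone: \<open>M\<close> is the marked set,
  \<open>S\<close> the cache at the start of the phase. Once \<open>M\<close> has \<open>k\<close>
  elements it is the whole cache and becomes the next \<open>S\<close>, so a request outside of it
  is clean. With \<open>S = {}\<close> all misses of the first phase count.\<close>

primrec clean_count :: "nat \<Rightarrow> 'a set \<Rightarrow> 'a set \<Rightarrow> 'a list \<Rightarrow> nat" where
  "clean_count k S M [] = 0"
| "clean_count k S M (z # zs) =
     (if z \<in> M then clean_count k S M zs
      else if card M < k then (if z \<in> S then 0 else 1) + clean_count k S (insert z M) zs
      else 1 + clean_count k M {z} zs)"

text \<open>Potential argument against the offline cache \<open>C\<close>. A clean request that hits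
  \<open>C\<close> lowers \<open>card (C - (S \<union> M))\<close>. An offline miss pays one for the
  request and one for the evicted element, which may enter \<open>M - C\<close>; hence the factor
  2.\<close>

lemma clean_count_le_offline_run:
  assumes "offline_run k C zs m" and "finite C" "card C \<le> k" "finite M" "card M \<le> k" "k \<ge> 1"
  shows "clean_count k S M zs \<le> 2 * m + card (C - (S \<union> M)) + card (M - C)"
proof -
  have hit_step: "clean_count k S M (z # zs) \<le> 2 * m + card (C - (S \<union> M)) + card (M - C)"
    if z: "z \<in> C" and IH: "\<And>S M. finite M \<Longrightarrow> card M \<le> k \<Longrightarrow>
        clean_count k S M zs \<le> 2 * m + card (C - (S \<union> M)) + card (M - C)"
      and C: "finite C" "card C \<le> k" and M: "finite M" "card M \<le> k" for z zs m C S M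
  proof -
    have base: "(if z \<in> S then 0 else 1) + clean_count k S (insert z M) zs
        \<le> 2 * m + card (C - (S \<union> M)) + card (M - C)"
      if zM: "z \<notin> M" and M: "finite M" "card M < k" for S M
    proof -
      have 1: "clean_count k S (insert z M) zs
          \<le> 2 * m + card (C - (S \<union> insert z M)) + card (insert z M - C)"
        using IH[of "insert z M" S] M zM by simp
      have 2: "insert z M - C = M - C" using z by auto
      have 3: "(if z \<in> S then 0 else 1) + card (C - (S \<union> insert z M)) \<le> card (C - (S \<union> M))"
      proof (cases "z \<in> S")
        case True
        then show ?thesis using C by (auto intro!: card_mono)
      next
        case False
        then have "C - (S \<union> insert z M) \<subset> C - (S \<union> M)" using z zM by auto
        then have "card (C - (S \<union> insert z M)) < card (C - (S \<union> M))"
          using C by (intro psubset_card_mono) auto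
        then show ?thesis using False by simp
      qed
      show ?thesis using 1 3 unfolding 2 by linarith
    qed
    show ?thesis
    proof (cases "z \<in> M \<or> card M < k")
      case True
      then show ?thesis using base[of M S] IH[of M S] M by (cases "z \<in> M") simp_all
    next
      case False
      then have cM: "card M = k" "z \<notin> M" using M by auto
      \<comment> \<open>At a phase change \<open>M\<close> takes the place of \<open>S\<close> and
        the marks are cleared, so the potential becomes \<open>card (C - M)\<close>. It does not
        grow, as \<open>M\<close> is full and \<open>C\<close> is no larger.\<close>
      have "card (C - M) \<le> card (M - C)"
        using C M cM card_le_sym_Diff[of C M] by simp
      moreover have "clean_count k S M (z # zs) \<le> 2 * m + card (C - M)"
        using base[of "{}" M] cM \<open>k \<ge> 1\<close> by simp
      ultimately show ?thesis by linarith
    qed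
  qed
  \<comment> \<open>\<open>D\<close> is what the offline algorithm keeps of \<open>C\<close>, which
    treats misses with and without an eviction together.\<close>
  have miss_step: "clean_count k S M (z # zs) \<le> 2 * Suc m + card (C - (S \<union> M)) + card (M - C)"
    if z: "z \<notin> C" and IH: "\<And>S M. finite M \<Longrightarrow> card M \<le> k \<Longrightarrow>
        clean_count k S M zs \<le> 2 * m + card (insert z D - (S \<union> M)) + card (M - insert z D)"
      and D: "D \<subseteq> C" "card (C - D) \<le> 1"
      and C: "finite C" "card C \<le> k" and M: "finite M" "card M \<le> k" for z zs m C D S M
  proof -
    have base: "1 + clean_count k S (insert z M) zs
        \<le> 2 * Suc m + card (C - (S \<union> M)) + card (M - C)"
      if M: "finite M" "card (insert z M) \<le> k" for S M
    proof -
      have 1: "clean_count k S (insert z M) zs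
          \<le> 2 * m + card (insert z D - (S \<union> insert z M)) + card (insert z M - insert z D)"
        using IH[of "insert z M" S] M by simp
      have 2: "card (insert z D - (S \<union> insert z M)) \<le> card (C - (S \<union> M))"
        using C D by (intro card_mono) auto
      have "card (insert z M - insert z D) \<le> card ((M - C) \<union> (C - D))"
        using C M by (intro card_mono) auto
      also have "\<dots> \<le> card (M - C) + card (C - D)" by (rule card_Un_le)
      finally show ?thesis using 1 2 D(2) unfolding mult_Suc_right by linarith
    qed
    show ?thesis
    proof (cases "z \<in> M \<or> card M < k")
      case True
      then show ?thesis using base[of M S] M by (auto simp: insert_absorb)
    next
      case False
      then have cM: "card M = k" "z \<notin> M" using M by auto
      have "card (C - M) \<le> card (M - C)"
        using C M cM card_le_sym_Diff[of C M] by simp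
      moreover have "clean_count k S M (z # zs) \<le> 2 * Suc m + card (C - M)"
        using base[of "{}" M] cM \<open>k \<ge> 1\<close> by simp
      ultimately show ?thesis by linarith
    qed
  qed
  show ?thesis
    using assms(1-5)
  proof (induction arbitrary: S M)
    case (finished C)
    then show ?case by simp
  next
    case (hit z C zs m)
    show ?case by (rule hit_step) (use hit.hyps hit.prems in \<open>simp_all add: hit.IH\<close>)
  next
    case (miss_room z C zs m)
    show ?case
      by (rule miss_step[of _ _ _ _ C])
        (use miss_room.hyps miss_room.prems in \<open>simp_all add: miss_room.IH\<close>)
  next
    case (miss_evict z C e zs m)
    have eq: "C - (C - {e}) = {e}" using miss_evict by auto
    have "card (insert z (C - {e})) \<le> k"
      using miss_evict.hyps miss_evict.prems \<open>k \<ge> 1\<close> by (simp add: card_insert_if card_Diff_singleton)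
    then show ?case by (intro miss_step[of _ _ _ _ "C - {e}"])
      (use miss_evict.hyps miss_evict.prems in \<open>simp_all add: miss_evict.IH eq\<close>)
  qed
qed

lemma offline_run_exists:
  assumes "finite C" "card C \<le> k" "k \<ge> 1"
  shows "\<exists>m. offline_run k C zs m"
  using assms(1,2)
proof (induction zs arbitrary: C)
  case Nil
  then show ?case by (auto intro: offline_run.intros)
next
  case (Cons z zs)
  consider "z \<in> C" | "z \<notin> C" "card C < k" | e where "z \<notin> C" "card C = k" "e \<in> C"
    using Cons.prems \<open>k \<ge> 1\<close> by (metis all_not_in_conv card.empty le_neq_implies_less not_one_le_zero)
  then show ?case
  proof cases
    case 1
    then show ?thesis using Cons by (meson offline_run.hit)
  next
    case 2
    then have "\<exists>m. offline_run k (insert z C) zs m" by (intro Cons.IH) (use Cons.prems in auto)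
    then show ?thesis using 2 by (meson offline_run.miss_room)
  next
    case 3
    have "card (insert z (C - {e})) \<le> k"
      using 3 Cons.prems \<open>k \<ge> 1\<close> by (simp add: card_insert_if card_Diff_singleton)
    then have "\<exists>m. offline_run k (insert z (C - {e})) zs m"
      by (intro Cons.IH) (use Cons.prems in auto)
    then show ?thesis using 3 by (meson offline_run.miss_evict)
  qed
qed

lemma offline_run_OPT: "k \<ge> 1 \<Longrightarrow> offline_run k {} \<sigma> (OPT k \<sigma>)"
  unfolding OPT_def using offline_run_exists[of "{}" k \<sigma>] by (auto intro: LeastI_ex)

lemma clean_count_le_OPT: "k \<ge> 1 \<Longrightarrow> clean_count k {} {} \<sigma> \<le> 2 * OPT k \<sigma>"
  using clean_count_le_offline_run[OF offline_run_OPT, of k "{}" "{}" \<sigma>] by simp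

lemma offline_run_card_new: "offline_run k C zs m \<Longrightarrow> card (set zs - C) \<le> m"
proof (induction rule: offline_run.induct)
  case (hit z C zs m)
  then have "set (z # zs) - C = set zs - C" by auto
  then show ?case using hit by simp
next
  case (miss_room z C zs m)
  have "card (set (z # zs) - C) \<le> card (insert z (set zs - insert z C))" by (intro card_mono) auto
  then show ?case using miss_room by (simp add: card_insert_if split: if_splits)
next
  case (miss_evict z C e zs m)
  have "card (set (z # zs) - C) \<le> card (insert z (set zs - insert z (C - {e})))"
    by (intro card_mono) auto
  then show ?case using miss_evict by (simp add: card_insert_if split: if_splits)
qed auto

lemma card_set_le_OPT: "k \<ge> 1 \<Longrightarrow> card (set \<sigma>) \<le> OPT k \<sigma>"
  using offline_run_card_new[OF offline_run_OPT, of k \<sigma>] by simp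

section \<open>Edit distance and common subsequences\<close>

lemma edit_step_common_subseq:
  assumes "edit_step ws ys" and "subseq zs ws"
  shows "\<exists>zs'. subseq zs' zs \<and> subseq zs' ys \<and> length zs \<le> Suc (length zs')"
  using assms
proof (induction)
  case (ins us vs x)
  then have "subseq zs (us @ x # vs)"
    by (meson list_emb_append_mono subseq_order.order_refl subseq_Cons' subseq_order.trans list_emb_Cons)
  then show ?case by auto
next
  case (del us x vs)
  then obtain as bs where "zs = as @ bs" "subseq as us" "subseq bs (x # vs)"
    by (auto elim: subseq_appendE)
  then show ?case
    by (intro exI[of _ "as @ (if subseq bs vs then bs else tl bs)"])
      (cases bs; auto intro: list_emb_append_mono split: if_splits)
next
  case (sub us x vs y)
  then obtain as bs where *: "zs = as @ bs" "subseq as us" "subseq bs (x # vs)"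
    by (auto elim: subseq_appendE)
  \<comment> \<open>Only the head of \<open>bs\<close> can be matched with the edited entry
    \<open>x\<close>, so dropping it suffices.\<close>
  define bs' where "bs' = (if subseq bs vs then bs else tl bs)"
  have "subseq bs' bs" "subseq bs' vs" "length bs \<le> Suc (length bs')"
    using *(3) by (cases bs; auto simp: bs'_def split: if_splits)+
  then show ?case using *(1,2)
    by (intro exI[of _ "as @ bs'"]) (auto intro!: list_emb_append_mono)
qed

lemma edit_relpow_common_subseq:
  "(edit_step ^^ d) xs ys \<Longrightarrow>
    \<exists>zs. subseq zs xs \<and> subseq zs ys \<and> length xs \<le> length zs + d"
proof (induction d arbitrary: ys)
  case 0
  then show ?case by auto
next
  case (Suc d)
  then obtain ws zs where "edit_step ws ys" "subseq zs xs" "subseq zs ws" "length xs \<le> length zs + d"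
    by (metis relpowp_Suc_E)
  moreover from this obtain zs' where "subseq zs' zs" "subseq zs' ys" "length zs \<le> Suc (length zs')"
    using edit_step_common_subseq by metis
  ultimately show ?case by (intro exI[of _ zs']) (auto intro: subseq_order.trans)
qed

text \<open>Ensures that the \<open>LEAST\<close> in \<open>edit_distance\<close> is attained:
  delete all of \<open>xs\<close>, then insert \<open>ys\<close>.\<close>

lemma edit_relpow_exists: "\<exists>d. (edit_step ^^ d) xs ys"
proof -
  have "edit_step\<^sup>*\<^sup>* xs []"
  proof (induction xs)
    case (Cons x xs)
    have "edit_step (x # xs) xs" using edit_step.del[of "[]" x xs] by simp
    then show ?case using Cons by (rule converse_rtranclp_into_rtranclp)
  qed simp
  also have "edit_step\<^sup>*\<^sup>* [] ys"
  proof (induction ys)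
    case (Cons y ys)
    have "edit_step ys (y # ys)" using edit_step.ins[of "[]" ys y] by simp
    with Cons show ?case by (rule rtranclp.rtrancl_into_rtrancl)
  qed simp
  finally show ?thesis by (simp add: rtranclp_power)
qed

lemma edit_distance_common_subseq:
  "\<exists>zs. subseq zs xs \<and> subseq zs ys \<and> length xs \<le> length zs + edit_distance xs ys"
proof (rule edit_relpow_common_subseq)
  show "(edit_step ^^ edit_distance xs ys) xs ys"
    unfolding edit_distance_def using edit_relpow_exists by (rule LeastI_ex)
qed

section \<open>Requests, evictions and chain values\<close>

text \<open>A request carries its prediction and a flag that says whether it is lost.\<close>

type_synonym 'a request = "('a \<times> nat) \<times> bool"

abbreviation elem :: "'a request \<Rightarrow> 'a" where "elem r \<equiv> fst (fst r)"

primrec next_lost :: "'a request list \<Rightarrow> 'a \<Rightarrow> bool option" where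
  "next_lost [] e = None"
| "next_lost (r # rs) e = (if elem r = e then Some (snd r) else next_lost rs e)"

text \<open>Also true if \<open>x\<close> is requested and \<open>e\<close> never is, so that an
  element without a next request counts as furthest.\<close>

primrec before :: "'a request list \<Rightarrow> 'a \<Rightarrow> 'a \<Rightarrow> bool" where
  "before [] x e = False"
| "before (r # rs) x e = (elem r = x \<or> elem r \<noteq> e \<and> before rs x e)"

lemma before_if_not_next: "next_lost rs e = None \<Longrightarrow> next_lost rs x \<noteq> None \<Longrightarrow> before rs x e"
  by (induction rs) (auto split: if_splits)

lemma before_total: "next_lost rs e \<noteq> None \<Longrightarrow> before rs x e \<or> before rs e x"
  by (induction rs) (auto split: if_splits)

text \<open>Breaks ties by the element, as \<open>furthest\<close> and \<open>pred_order\<close>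
  do.\<close>

definition lex_less :: "('a::linorder \<Rightarrow> nat) \<Rightarrow> 'a \<Rightarrow> 'a \<Rightarrow> bool" where
  "lex_less lp e x \<longleftrightarrow> lp e < lp x \<or> lp e = lp x \<and> e < x"

definition good_ordered :: "'a::linorder set \<Rightarrow> ('a \<Rightarrow> nat) \<Rightarrow> 'a request list \<Rightarrow> bool" where
  "good_ordered D lp rs \<longleftrightarrow> (\<forall>e\<in>D. \<forall>x\<in>D. e \<noteq> x \<and> next_lost rs e = Some False \<and>
     next_lost rs x = Some False \<and> before rs e x \<longrightarrow> lex_less lp e x)"

text \<open>At every later time, the requests that are not lost arrive in the order of the predictions
  recorded at that time for the elements \<open>D\<close> seen so far.\<close>

primrec consistent :: "'a::linorder set \<Rightarrow> ('a \<Rightarrow> nat) \<Rightarrow> 'a request list \<Rightarrow> bool" where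
  "consistent D lp [] \<longleftrightarrow> True"
| "consistent D lp (r # rs) \<longleftrightarrow>
     good_ordered (insert (elem r) D) (lp(elem r := snd (fst r))) rs \<and>
     consistent (insert (elem r) D) (lp(elem r := snd (fst r))) rs"

text \<open>If \<open>e\<close> is safe, then at its return no unmarked element in the cache is next requested by a
  request that is not lost.\<close>

definition safe :: "'a set \<Rightarrow> 'a request list \<Rightarrow> 'a \<Rightarrow> bool" where
  "safe U rs e \<longleftrightarrow> (\<forall>x\<in>U. next_lost rs x = Some False \<longrightarrow> before rs x e)"

lemma safe_Cons:
  "safe U (r # rs) e \<Longrightarrow> e \<noteq> elem r \<Longrightarrow> U' \<subseteq> U - {elem r} \<Longrightarrow> safe U' rs e"
  unfolding safe_def by (metis DiffE before.simps(2) insertI1 next_lost.simps(2) subsetD)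

text \<open>Nothing precedes the head of the list, so \<open>before\<close> fails for every
  \<open>x\<close> in \<open>U\<close>.\<close>

lemma safe_arrival:
  "safe U (r # rs) (elem r) \<Longrightarrow> elem r \<notin> U \<Longrightarrow> x \<in> U \<Longrightarrow> next_lost rs x \<noteq> Some False"
  unfolding safe_def by (metis before.simps(2) next_lost.simps(2))

lemma furthest_lex_max:
  assumes "finite (unmarked s)" "unmarked s \<noteq> {}"
  shows "furthest s \<in> unmarked s"
    and "x \<in> unmarked s \<Longrightarrow> \<not> lex_less (latest_pred s) (furthest s) x"
proof -
  let ?F = "{e \<in> unmarked s. \<forall>e' \<in> unmarked s. latest_pred s e' \<le> latest_pred s e}"
  have fin: "finite ?F" using assms by simp
  have "Max (latest_pred s ` unmarked s) \<in> latest_pred s ` unmarked s"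
    using assms by (intro Max_in) auto
  then obtain e where "e \<in> unmarked s" "latest_pred s e = Max (latest_pred s ` unmarked s)"
    by auto
  then have "e \<in> ?F" using assms by auto
  then have max: "furthest s \<in> ?F" unfolding furthest_def using fin by (intro Max_in) auto
  then show "furthest s \<in> unmarked s" by simp
  show "\<not> lex_less (latest_pred s) (furthest s) x" if x: "x \<in> unmarked s"
  proof
    assume *: "lex_less (latest_pred s) (furthest s) x"
    with x max have "latest_pred s (furthest s) = latest_pred s x" "furthest s < x"
      by (auto simp: lex_less_def leD)
    moreover from this x max have "x \<in> ?F" by auto
    then have "x \<le> furthest s" unfolding furthest_def using fin by (intro Max_ge) auto
    ultimately show False by simp
  qed
qed

text \<open>If the evicted element returned before some \<open>x\<close> and neither request were
  lost, \<open>good_ordered\<close> would put its prediction below that of \<open>x\<close>, against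
  maximality. If it never returns, \<open>before\<close> holds anyway.\<close>

lemma furthest_safe:
  assumes "finite (unmarked s)" "unmarked s \<noteq> {}" and "unmarked s \<subseteq> D"
    and "good_ordered D (latest_pred s) rs"
    and "next_lost rs (furthest s) \<noteq> Some True"
  shows "safe (unmarked s - {furthest s}) rs (furthest s)"
  unfolding safe_def
proof (intro ballI impI)
  fix x assume x: "x \<in> unmarked s - {furthest s}" "next_lost rs x = Some False"
  show "before rs x (furthest s)"
  proof (cases "next_lost rs (furthest s)")
    case None
    then show ?thesis using x by (simp add: before_if_not_next)
  next
    case (Some b)
    then have good: "next_lost rs (furthest s) = Some False" using assms(5) by (cases b) auto
    have "furthest s \<in> D" "x \<in> D" using furthest_lex_max(1)[OF assms(1,2)] x(1) assms(3) by auto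
    moreover have "\<not> lex_less (latest_pred s) (furthest s) x"
      using furthest_lex_max(2)[OF assms(1,2)] x(1) by simp
    ultimately have "\<not> before rs (furthest s) x"
      using assms(4) good x unfolding good_ordered_def by (metis DiffE singletonI)
    then show ?thesis using before_total[of rs "furthest s" x] good by simp
  qed
qed

text \<open>The number of elements marked when \<open>e\<close> is next requested does not depend on the evictions,
  so \<open>chain_value\<close> is deterministic. After the current phase it vanishes because of the truncated
  subtraction and \<open>harm 0 = 0\<close>.\<close>

primrec chain_value :: "nat \<Rightarrow> 'a set \<Rightarrow> 'a request list \<Rightarrow> 'a \<Rightarrow> real" where
  "chain_value k M [] e = 0"
| "chain_value k M (r # rs) e =
     (if elem r = e then harm (k - card M) else chain_value k (insert (elem r) M) rs e)"

lemma chain_value_nonneg: "0 \<le> chain_value k M rs e"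
  by (induction rs arbitrary: M) (auto simp: harm_nonneg)

lemma chain_value_le: "chain_value k M rs e \<le> harm k"
  by (induction rs arbitrary: M) (auto simp: harm_nonneg intro: harm_mono)

text \<open>Each arrival of an element of \<open>U\<close> marks it, so the next one sees a smaller
  \<open>k - card M\<close>: the positive values are \<open>harm v\<close> for distinct
  \<open>v\<close>. Arrivals after the phase contribute \<open>harm 0 = 0\<close>.\<close>

lemma sum_chain_value_le:
  assumes "finite M" "finite U" "U \<inter> M = {}"
  shows "(\<Sum>e\<in>U. chain_value k M rs e) \<le> (\<Sum>v\<le>k - card M. harm v)"
  using assms
proof (induction rs arbitrary: M U)
  case Nil
  then show ?case by (simp add: sum_nonneg harm_nonneg)
next
  case (Cons r rs)
  let ?z = "elem r"
  have eq: "(\<Sum>e\<in>U - {?z}. chain_value k M (r # rs) e) = (\<Sum>e\<in>U - {?z}. chain_value k (insert ?z M) rs e)"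
    by (intro sum.cong) auto
  have IH: "(\<Sum>e\<in>U - {?z}. chain_value k (insert ?z M) rs e) \<le> (\<Sum>v\<le>k - card (insert ?z M). harm v)"
    using Cons.prems by (intro Cons.IH) auto
  show ?case
  proof (cases "?z \<in> U")
    case True
    then have z: "?z \<notin> M" using Cons.prems by auto
    have "(\<Sum>e\<in>U. chain_value k M (r # rs) e) =
        harm (k - card M) + (\<Sum>e\<in>U - {?z}. chain_value k (insert ?z M) rs e)"
      using True Cons.prems eq by (subst sum.remove[of U ?z]) auto
    also have "\<dots> \<le> harm (k - card M) + (\<Sum>v\<le>k - Suc (card M). harm v)"
      using IH z Cons.prems by simp
    also have "\<dots> = (\<Sum>v\<le>k - card M. harm v)"
    proof (cases "k - card M")
      case 0
      then show ?thesis by (simp add: harm_def)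
    next
      case (Suc n)
      then have "k - Suc (card M) = n" by simp
      then show ?thesis using Suc by simp
    qed
    finally show ?thesis .
  next
    case False
    have "(\<Sum>v\<le>k - card (insert ?z M). harm v :: real) \<le> (\<Sum>v\<le>k - card M. harm v)"
      using Cons.prems by (intro sum_mono2) (auto simp: harm_nonneg card_insert_if)
    then show ?thesis using IH eq False by simp
  qed
qed

lemma sum_harm: "(\<Sum>v\<le>n. harm v) = real (Suc n) * harm (Suc n) - real (Suc n)"
proof (induction n)
  case 0
  then show ?case by (simp add: harm_def)
next
  case (Suc n)
  have "real (Suc (Suc n)) * harm (Suc (Suc n)) = real (Suc (Suc n)) * harm (Suc n) + 1"
    by (subst harm_Suc) (simp add: distrib_left)
  then show ?case using Suc by (simp add: algebra_simps)
qed

text \<open>Multiplied by \<open>card U\<close>, this says that a uniform eviction is paid by the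
  value \<open>harm (k - card M)\<close> of the arriving \<open>z\<close>. Marking \<open>z\<close>
  first leaves only \<open>v < card U\<close> for the candidates.\<close>

lemma sum_chain_value_uniform:
  assumes "finite M" "finite U" "U \<inter> insert z M = {}" "z \<notin> M" "card U = k - card M" "U \<noteq> {}"
  shows "(\<Sum>e\<in>U. 1 + chain_value k (insert z M) rs e) \<le> real (card U) * harm (k - card M)"
proof -
  obtain n where n: "card U = Suc n" using assms by (metis card_gt_0_iff gr0_implies_Suc)
  have "k - card (insert z M) = n" using assms n by simp
  then have "(\<Sum>e\<in>U. chain_value k (insert z M) rs e) \<le> (\<Sum>v\<le>n. harm v)"
    using sum_chain_value_le[of "insert z M" U k rs] assms by simp
  then show ?thesis
    using n assms by (simp add: sum.distrib sum_harm)
qed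

section \<open>Potential of a run\<close>

text \<open>The representatives are exactly the evicted elements of the phase set, so a stale miss
  always finds its chain. While the cache has room, the empty phase set forces all cached elements
  to be marked and excludes chains.\<close>

definition pm_inv :: "nat \<Rightarrow> 'a pm_state \<Rightarrow> bool" where
  "pm_inv k s \<longleftrightarrow> finite (cache s) \<and> card (cache s) \<le> k \<and> marked s \<subseteq> cache s \<and>
     cache s \<subseteq> phase_set s \<union> marked s \<and> distinct (map fst (chains s)) \<and>
     fst ` set (chains s) = phase_set s - cache s \<and> (card (cache s) < k \<longrightarrow> phase_set s = {})"

lemma pm_inv_init: "k \<ge> 1 \<Longrightarrow> pm_inv k pm_init"
  by (simp add: pm_inv_def pm_init_def)

lemma pm_inv_new_phase: "pm_inv k s \<Longrightarrow> card (cache s) = k \<Longrightarrow> pm_inv k (new_phase s)"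
  by (simp add: pm_inv_def new_phase_def)

lemma pm_inv_latest_pred [simp]: "pm_inv k (s\<lparr>latest_pred := p\<rparr>) = pm_inv k s"
  by (simp add: pm_inv_def)

lemma unmarked_latest_pred [simp]: "unmarked (s\<lparr>latest_pred := p\<rparr>) = unmarked s"
  by (simp add: unmarked_def)

lemma pm_inv_card_unmarked:
  "pm_inv k s \<Longrightarrow> card (cache s) = k \<Longrightarrow> card (unmarked s) = k - card (marked s)"
  unfolding pm_inv_def unmarked_def by (metis card_Diff_subset finite_subset)

lemma pm_inv_replace_clean:
  assumes "pm_inv k s" "card (cache s) = k" "z \<notin> cache s" "z \<notin> phase_set s" "e \<in> unmarked s"
  shows "pm_inv k (replace z e (chains s @ [(e, n)]) s)"
proof -
  have e: "e \<in> cache s" "e \<notin> marked s" "e \<in> phase_set s"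
    using assms by (auto simp: pm_inv_def unmarked_def)
  then have "card (insert z (cache s - {e})) = k"
    using assms by (metis card_insert_disjoint card_Suc_Diff1 finite_Diff pm_inv_def DiffD1)
  moreover have ch: "fst ` set (chains s) = phase_set s - cache s" "distinct (map fst (chains s))"
    using assms by (simp_all add: pm_inv_def)
  moreover have "insert e (phase_set s - cache s) = phase_set s - insert z (cache s - {e})"
    using assms(4) e by blast
  moreover have "insert z (cache s - {e}) \<subseteq> phase_set s \<union> insert z (marked s)"
    and "insert z (marked s) \<subseteq> insert z (cache s - {e})" and "finite (cache s)"
    using assms(1) e by (auto simp: pm_inv_def)
  ultimately show ?thesis
    using e(1) by (simp add: pm_inv_def replace_def)
qed

lemma pm_inv_replace_stale:
  assumes "pm_inv k s" "card (cache s) = k" "z \<notin> cache s" "e \<in> unmarked s"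
    and "chains s = xs @ (z, n) # ys"
  shows "pm_inv k (replace z e (xs @ (e, m) # ys) s)"
proof -
  have e: "e \<in> cache s" "e \<notin> marked s" "e \<in> phase_set s"
    using assms by (auto simp: pm_inv_def unmarked_def)
  then have "card (insert z (cache s - {e})) = k"
    using assms by (metis card_insert_disjoint card_Suc_Diff1 finite_Diff pm_inv_def DiffD1)
  moreover have "insert z (fst ` (set xs \<union> set ys)) = phase_set s - cache s"
    and "z \<notin> fst ` (set xs \<union> set ys)" and dist: "distinct (map fst (xs @ ys))"
    using assms(1,5) by (auto simp: pm_inv_def)
  then have ch: "fst ` set xs \<union> fst ` set ys = phase_set s - cache s - {z}"
    by (auto simp: image_Un)
  have "insert e (phase_set s - cache s - {z}) = phase_set s - insert z (cache s - {e})"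
    using assms(3) e by blast
  moreover have "e \<notin> fst ` set xs" "e \<notin> fst ` set ys" using ch e by blast+
  moreover have "insert z (cache s - {e}) \<subseteq> phase_set s \<union> insert z (marked s)"
    and "insert z (marked s) \<subseteq> insert z (cache s - {e})" and "finite (cache s)"
    using assms(1) e by (auto simp: pm_inv_def)
  ultimately show ?thesis
    using dist ch by (simp add: pm_inv_def replace_def image_Un)
qed

text \<open>Representatives are distinct, so the index chosen by \<open>THE\<close> is unique and
  the update becomes a split of the chain list.\<close>

lemma serve_stale_eq:
  assumes "pm_inv k s" "z \<notin> cache s" "z \<in> phase_set s"
  obtains xs n ys where "chains s = xs @ (z, n) # ys" "z \<notin> fst ` set (xs @ ys)"
    "\<And>\<tau>. serve_stale \<tau> z s = map_pmf (\<lambda>e. replace z e (xs @ (e, Suc n) # ys) s)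
       (if real (Suc n) \<le> \<tau> then return_pmf (furthest s) else pmf_of_set (unmarked s))"
proof -
  have "z \<in> fst ` set (chains s)" using assms by (auto simp: pm_inv_def)
  then obtain n where "(z, n) \<in> set (chains s)" by auto
  then obtain xs ys where ch: "chains s = xs @ (z, n) # ys" by (auto simp: in_set_conv_decomp)
  then have notin: "z \<notin> fst ` set (xs @ ys)" using assms by (auto simp: pm_inv_def)
  have dist: "distinct (map fst (chains s))" using assms by (simp add: pm_inv_def)
  have "(THE c. c < length (chains s) \<and> fst (chains s ! c) = z) = length xs"
  proof (rule the_equality)
    show "length xs < length (chains s) \<and> fst (chains s ! length xs) = z" using ch by simp
    fix c assume c: "c < length (chains s) \<and> fst (chains s ! c) = z"
    then have "map fst (chains s) ! c = z" by simp
    moreover have "map fst (chains s) ! length xs = z" using ch by (simp add: nth_append)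
    ultimately show "c = length xs"
      using c ch by (intro nth_eq_iff_index_eq[OF dist, THEN iffD1]) auto
  qed
  then have "serve_stale \<tau> z s = map_pmf (\<lambda>e. replace z e (xs @ (e, Suc n) # ys) s)
       (if real (Suc n) \<le> \<tau> then return_pmf (furthest s) else pmf_of_set (unmarked s))" for \<tau>
    using ch unfolding serve_stale_def Let_def by simp
  then show ?thesis using that ch notin by blast
qed

text \<open>\<open>a\<close> is the credit of a clean request, \<open>\<phi> U M rs e n\<close> the credit held by a chain of length \<open>n\<close> with
  representative \<open>e\<close>, where \<open>U\<close> are the unmarked cached and \<open>M\<close> the marked elements, and \<open>\<rho>\<close> a budget from
  which evicting \<open>e\<close> takes \<open>release rs e\<close>.\<close>

locale chain_potential =
  fixes k :: nat and a :: real
    and \<phi> :: "'a::linorder set \<Rightarrow> 'a set \<Rightarrow> 'a request list \<Rightarrow> 'a \<Rightarrow> nat \<Rightarrow> real"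
    and \<rho> :: "'a set \<Rightarrow> 'a request list \<Rightarrow> real"
    and release :: "'a request list \<Rightarrow> 'a \<Rightarrow> real"
  assumes k_pos: "k \<ge> 1"
    and a_ge_1: "a \<ge> 1"
    and \<phi>_nonneg: "0 \<le> \<phi> U M rs e n"
    and \<rho>_nonneg: "0 \<le> \<rho> C rs"
    and \<phi>_Cons: "e \<noteq> elem r \<Longrightarrow> U' \<subseteq> U - {elem r} \<Longrightarrow>
      \<phi> U' (insert (elem r) M) rs e n \<le> \<phi> U M (r # rs) e n"
    and \<rho>_Cons: "\<rho> (insert (elem r) C) rs \<le> \<rho> C (r # rs)"
    and \<rho>_evict: "finite C \<Longrightarrow> e \<in> C \<Longrightarrow> \<rho> (C - {e}) rs + release rs e \<le> \<rho> C rs"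
    and clean: "e \<in> U \<Longrightarrow> (next_lost rs e \<noteq> Some True \<Longrightarrow> safe (U - {e}) rs e) \<Longrightarrow>
      1 + \<phi> (U - {e}) M rs e 1 \<le> a + release rs e"
    and stale_furthest: "e \<in> U \<Longrightarrow> elem r \<notin> U \<Longrightarrow>
      (next_lost rs e \<noteq> Some True \<Longrightarrow> safe (U - {e}) rs e) \<Longrightarrow> real (Suc n) \<le> harm k \<Longrightarrow>
      1 + \<phi> (U - {e}) (insert (elem r) M) rs e (Suc n) \<le> \<phi> U M (r # rs) (elem r) n + release rs e"
    and stale_random: "finite U \<Longrightarrow> U \<noteq> {} \<Longrightarrow> finite M \<Longrightarrow> U \<inter> M = {} \<Longrightarrow> elem r \<notin> U \<Longrightarrow>
      elem r \<notin> M \<Longrightarrow> card U = k - card M \<Longrightarrow> \<not> real (Suc n) \<le> harm k \<Longrightarrow>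
      (\<Sum>e\<in>U. 1 + \<phi> (U - {e}) (insert (elem r) M) rs e (Suc n) - release rs e)
        \<le> real (card U) * \<phi> U M (r # rs) (elem r) n"
begin

definition chains_pot :: "'a set \<Rightarrow> 'a set \<Rightarrow> 'a request list \<Rightarrow> ('a \<times> nat) list \<Rightarrow> real" where
  "chains_pot U M rs cs = (\<Sum>(e, n)\<leftarrow>cs. \<phi> U M rs e n)"

definition potential :: "'a pm_state \<Rightarrow> 'a request list \<Rightarrow> real" where
  "potential s rs = chains_pot (unmarked s) (marked s) rs (chains s) +
     a * real (clean_count k (phase_set s) (marked s) (map elem rs)) + \<rho> (cache s) rs"

lemma chains_pot_nonneg: "0 \<le> chains_pot U M rs cs"
  unfolding chains_pot_def by (induction cs) (auto simp: \<phi>_nonneg)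

lemma chains_pot_append [simp]:
  "chains_pot U M rs (xs @ ys) = chains_pot U M rs xs + chains_pot U M rs ys"
  "chains_pot U M rs ((e, n) # ys) = \<phi> U M rs e n + chains_pot U M rs ys"
  "chains_pot U M rs [] = 0"
  by (simp_all add: chains_pot_def)

lemma chains_pot_Cons:
  assumes "elem r \<notin> fst ` set cs" "U' \<subseteq> U - {elem r}"
  shows "chains_pot U' (insert (elem r) M) rs cs \<le> chains_pot U M (r # rs) cs"
  using assms by (induction cs) (auto intro!: add_mono \<phi>_Cons)

lemma potential_nonneg: "0 \<le> potential s rs"
  using a_ge_1 by (simp add: potential_def chains_pot_nonneg \<rho>_nonneg)

lemma potential_latest_pred [simp]: "potential (s\<lparr>latest_pred := p\<rparr>) rs = potential s rs"
  by (simp add: potential_def)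

text \<open>The credits of the old chains are dropped. The clean count is unchanged, because
  \<open>clean_count\<close> makes the same switch when the full set \<open>M\<close> meets a
  request outside of it.\<close>

lemma potential_new_phase:
  assumes "pm_inv k s" "card (cache s) = k" "cache s \<subseteq> marked s" "elem r \<notin> cache s"
  shows "potential (new_phase s) (r # rs) \<le> potential s (r # rs)"
proof -
  have "marked s = cache s" using assms by (auto simp: pm_inv_def)
  then show ?thesis
    using assms k_pos chains_pot_nonneg by (simp add: potential_def new_phase_def)
qed

text \<open>Bookkeeping shared by both kinds of misses: a clean request lowers the clean count by
  one and so frees \<open>a\<close>, and the eviction frees \<open>release rs e\<close>.\<close>

lemma potential_replace:
  assumes inv: "pm_inv k s" and e: "e \<in> unmarked s" and z: "elem r \<notin> cache s"
    and notfull: "\<not> cache s \<subseteq> marked s" "card (cache s) = k"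
  shows "potential (replace (elem r) e cs s) rs + release rs e \<le>
    chains_pot (unmarked s - {e}) (insert (elem r) (marked s)) rs cs +
    a * (real (clean_count k (phase_set s) (marked s) (map elem (r # rs))) - (if elem r \<in> phase_set s then 0 else 1)) +
    \<rho> (cache s) (r # rs)"
proof -
  let ?z = "elem r"
  have zM: "?z \<notin> marked s" "finite (cache s)" "marked s \<subset> cache s"
    using inv z notfull by (auto simp: pm_inv_def)
  then have "card (marked s) < k" using notfull psubset_card_mono by blast
  then have cc: "real (clean_count k (phase_set s) (marked s) (map elem (r # rs))) - (if ?z \<in> phase_set s then 0 else 1)
      = real (clean_count k (phase_set s) (insert ?z (marked s)) (map elem rs))"
    using zM by simp
  have "?z \<noteq> e" using e z by (auto simp: unmarked_def)
  then have C: "insert ?z (cache s - {e}) = insert ?z (cache s) - {e}"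
    and U: "unmarked (replace ?z e cs s) = unmarked s - {e}"
    using z by (auto simp: unmarked_def replace_def)
  have "\<rho> (insert ?z (cache s) - {e}) rs + release rs e \<le> \<rho> (insert ?z (cache s)) rs"
    using zM e by (intro \<rho>_evict) (auto simp: unmarked_def)
  also have "\<dots> \<le> \<rho> (cache s) (r # rs)" by (rule \<rho>_Cons)
  finally show ?thesis
    unfolding potential_def cc U by (simp add: replace_def C)
qed

text \<open>Finite support turns expectations into finite sums; the remaining conditions let the
  induction over the requests continue.\<close>

definition descends :: "'a pm_state \<Rightarrow> 'a request \<Rightarrow> 'a request list \<Rightarrow> 'a pm_state pmf \<Rightarrow> bool" where
  "descends s r rs p \<longleftrightarrow> finite (set_pmf p) \<and>
     (\<forall>s'\<in>set_pmf p. pm_inv k s' \<and> cache s' \<subseteq> insert (elem r) (cache s) \<and> latest_pred s' = latest_pred s) \<and>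
     measure_pmf.expectation p (\<lambda>s'. real (misses s') + potential s' rs)
       \<le> real (misses s) + potential s (r # rs)"

lemma descends_serve_clean:
  assumes inv: "pm_inv k s" and z: "elem r \<notin> cache s" "elem r \<notin> phase_set s"
    and notfull: "\<not> cache s \<subseteq> marked s" "card (cache s) = k"
    and order: "cache s \<subseteq> D" "good_ordered D (latest_pred s) rs"
  shows "descends s r rs (serve_clean (elem r) s)"
proof -
  let ?z = "elem r" and ?e = "furthest s" and ?U = "unmarked s" and ?M = "marked s"
  let ?s' = "replace ?z ?e (chains s @ [(?e, 1)]) s"
  have U: "finite ?U" "?U \<noteq> {}" "?U \<subseteq> D"
    using inv notfull order by (auto simp: unmarked_def pm_inv_def)
  have e: "?e \<in> ?U" using furthest_lex_max(1)[OF U(1,2)] .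
  have zU: "?z \<notin> ?U" using z by (auto simp: unmarked_def)
  have "1 + \<phi> (?U - {?e}) (insert ?z ?M) rs ?e 1 \<le> a + release rs ?e"
    using e furthest_safe[OF U order(2)] by (intro clean)
  moreover have "chains_pot (?U - {?e}) (insert ?z ?M) rs (chains s) \<le> chains_pot ?U ?M (r # rs) (chains s)"
    using inv z zU by (intro chains_pot_Cons) (auto simp: pm_inv_def)
  moreover note potential_replace[OF inv e z(1) notfull, of "chains s @ [(?e, 1)]" rs]
  ultimately have "1 + potential ?s' rs \<le> potential s (r # rs)"
    using z(2) unfolding potential_def[of s] by (simp add: algebra_simps)
  moreover have "pm_inv k ?s'" using pm_inv_replace_clean[OF inv notfull(2) z e] .
  moreover have "misses ?s' = Suc (misses s)" "latest_pred ?s' = latest_pred s"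
    "cache ?s' \<subseteq> insert ?z (cache s)"
    by (auto simp: replace_def)
  ultimately show ?thesis
    unfolding descends_def serve_clean_def by simp
qed

lemma descends_serve_stale:
  assumes inv: "pm_inv k s" and z: "elem r \<notin> cache s" "elem r \<in> phase_set s"
    and notfull: "\<not> cache s \<subseteq> marked s" "card (cache s) = k"
    and order: "cache s \<subseteq> D" "good_ordered D (latest_pred s) rs"
  shows "descends s r rs (serve_stale (harm k) (elem r) s)"
proof -
  let ?z = "elem r" and ?U = "unmarked s" and ?M = "marked s"
  obtain xs n ys where ch: "chains s = xs @ (?z, n) # ys" and notin: "?z \<notin> fst ` set (xs @ ys)"
    and serve: "\<And>\<tau>. serve_stale \<tau> ?z s = map_pmf (\<lambda>e. replace ?z e (xs @ (e, Suc n) # ys) s)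
       (if real (Suc n) \<le> \<tau> then return_pmf (furthest s) else pmf_of_set (unmarked s))"
    using serve_stale_eq[OF inv z] by blast
  define s' where "s' = (\<lambda>e. replace ?z e (xs @ (e, Suc n) # ys) s)"
  have U: "finite ?U" "?U \<noteq> {}" "?U \<subseteq> D"
    using inv notfull order by (auto simp: unmarked_def pm_inv_def)
  have zU: "?z \<notin> ?U" "?z \<notin> ?M" using z inv by (auto simp: unmarked_def pm_inv_def)
  have s'_props: "pm_inv k (s' e)" "misses (s' e) = Suc (misses s)" "latest_pred (s' e) = latest_pred s"
    "cache (s' e) \<subseteq> insert ?z (cache s)" if "e \<in> ?U" for e
    using pm_inv_replace_stale[OF inv notfull(2) z(1) that ch] by (auto simp: s'_def replace_def)
  \<comment> \<open>Only the credit of the chain continued by \<open>?z\<close> and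
    \<open>release rs e\<close> depend on \<open>e\<close> in this bound, so each kind of eviction
    reduces to one locale assumption.\<close>
  have pot: "potential (s' e) rs + \<phi> ?U ?M (r # rs) ?z n
      \<le> potential s (r # rs) + (\<phi> (?U - {e}) (insert ?z ?M) rs e (Suc n) - release rs e)"
    if e: "e \<in> ?U" for e
  proof -
    have "chains_pot (?U - {e}) (insert ?z ?M) rs (xs @ ys) \<le> chains_pot ?U ?M (r # rs) (xs @ ys)"
      using notin zU by (intro chains_pot_Cons) auto
    moreover note potential_replace[OF inv e z(1) notfull, of "xs @ (e, Suc n) # ys" rs]
    ultimately show ?thesis
      using z(2) unfolding potential_def[of s] s'_def ch by (simp add: algebra_simps)
  qed
  show ?thesis
  proof (cases "real (Suc n) \<le> harm k")
    case True
    let ?e = "furthest s"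
    have e: "?e \<in> ?U" using furthest_lex_max(1)[OF U(1,2)] .
    have "1 + \<phi> (?U - {?e}) (insert ?z ?M) rs ?e (Suc n) \<le> \<phi> ?U ?M (r # rs) ?z n + release rs ?e"
      using e zU True furthest_safe[OF U order(2)] by (intro stale_furthest)
    then have "1 + potential (s' ?e) rs \<le> potential s (r # rs)" using pot[OF e] by linarith
    moreover have "serve_stale (harm k) ?z s = return_pmf (s' ?e)"
      using True by (simp add: serve s'_def)
    ultimately show ?thesis unfolding descends_def using s'_props[OF e] by simp
  next
    case False
    have M: "finite ?M" "?U \<inter> ?M = {}" "card ?U = k - card ?M"
      using inv pm_inv_card_unmarked[OF inv notfull(2)]
      by (auto simp: pm_inv_def unmarked_def intro: finite_subset)
    have "(\<Sum>e\<in>?U. real (misses (s' e)) + potential (s' e) rs) \<le>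
        (\<Sum>e\<in>?U. real (misses s) + potential s (r # rs) - \<phi> ?U ?M (r # rs) ?z n +
          (1 + \<phi> (?U - {e}) (insert ?z ?M) rs e (Suc n) - release rs e))"
      using pot s'_props(2) by (intro sum_mono) (simp add: algebra_simps)
    also have "\<dots> = real (card ?U) * (real (misses s) + potential s (r # rs) - \<phi> ?U ?M (r # rs) ?z n) +
        (\<Sum>e\<in>?U. 1 + \<phi> (?U - {e}) (insert ?z ?M) rs e (Suc n) - release rs e)"
      by (simp only: sum.distrib sum_constant)
    also have "\<dots> \<le> real (card ?U) * (real (misses s) + potential s (r # rs))"
      using stale_random[OF U(1,2) M(1,2) zU M(3) False, of rs] by (simp add: algebra_simps)
    finally have "(\<Sum>e\<in>?U. real (misses (s' e)) + potential (s' e) rs) / real (card ?U)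
        \<le> real (misses s) + potential s (r # rs)"
      using U by (simp add: pos_divide_le_eq card_gt_0_iff mult.commute)
    moreover have "serve_stale (harm k) ?z s = map_pmf s' (pmf_of_set ?U)"
      using False by (simp add: serve s'_def)
    ultimately show ?thesis
      unfolding descends_def using s'_props U by (simp add: integral_pmf_of_set)
  qed
qed

lemma descends_serve_full_miss:
  assumes inv: "pm_inv k s" and z: "elem r \<notin> cache s" and full: "card (cache s) = k"
    and order: "cache s \<subseteq> D" "good_ordered D (latest_pred s) rs"
  shows "descends s r rs (serve_full_miss (harm k) (elem r) s)"
proof -
  define s' where "s' = (if cache s \<subseteq> marked s then new_phase s else s)"
  have s': "cache s' = cache s" "latest_pred s' = latest_pred s" "misses s' = misses s"
    by (simp_all add: s'_def new_phase_def)
  have inv': "pm_inv k s'" using inv full by (simp add: s'_def pm_inv_new_phase)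
  have "cache s \<noteq> {}" using full k_pos by auto
  then have notfull: "\<not> cache s' \<subseteq> marked s'" by (auto simp: s'_def new_phase_def)
  have "descends s' r rs (if elem r \<notin> phase_set s' then serve_clean (elem r) s' else serve_stale (harm k) (elem r) s')"
    using descends_serve_clean[of s' r D rs] descends_serve_stale[of s' r D rs] inv' notfull assms s'
    by auto
  moreover have "potential s' (r # rs) \<le> potential s (r # rs)"
    using potential_new_phase[OF inv full] z by (simp add: s'_def)
  ultimately show ?thesis
    unfolding serve_full_miss_def Let_def s'_def[symmetric] descends_def s' by (meson add_left_mono order_trans)
qed

lemma descends_pm_step:
  assumes inv: "pm_inv k s" and D: "cache s \<subseteq> D"
    and order: "good_ordered (insert (elem r) D) ((latest_pred s)(elem r := snd (fst r))) rs"
  shows "descends (s\<lparr>latest_pred := (latest_pred s)(elem r := snd (fst r))\<rparr>) r rs (pm_step k (harm k) (fst r) s)"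
proof -
  define s1 where "s1 = s\<lparr>latest_pred := (latest_pred s)(elem r := snd (fst r))\<rparr>"
  let ?z = "elem r"
  have inv1: "pm_inv k s1" using inv by (simp add: s1_def)
  have step: "pm_step k (harm k) (fst r) s =
     (if ?z \<in> cache s1 then return_pmf (s1\<lparr>marked := insert ?z (marked s1)\<rparr>)
        else if card (cache s1) < k then
          return_pmf (s1\<lparr>cache := insert ?z (cache s1), marked := insert ?z (marked s1),
            misses := Suc (misses s1)\<rparr>)
        else serve_full_miss (harm k) ?z s1)"
    unfolding pm_step_def s1_def Let_def by (simp add: case_prod_beta)
  consider "?z \<in> cache s1" | "?z \<notin> cache s1" "card (cache s1) < k" | "?z \<notin> cache s1" "card (cache s1) = k"
    using inv1 le_neq_implies_less unfolding pm_inv_def by blast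
  then have "descends s1 r rs (pm_step k (harm k) (fst r) s)"
  proof cases
    case 1
    let ?s' = "s1\<lparr>marked := insert ?z (marked s1)\<rparr>"
    have U: "unmarked ?s' \<subseteq> unmarked s1 - {?z}" by (auto simp: unmarked_def)
    have "chains_pot (unmarked ?s') (insert ?z (marked s1)) rs (chains s1)
        \<le> chains_pot (unmarked s1) (marked s1) (r # rs) (chains s1)"
      using inv1 1 U by (intro chains_pot_Cons) (auto simp: pm_inv_def)
    moreover have "\<rho> (cache s1) rs \<le> \<rho> (cache s1) (r # rs)"
      using \<rho>_Cons[of r "cache s1" rs] 1 by (simp add: insert_absorb)
    moreover have "clean_count k (phase_set s1) (insert ?z (marked s1)) (map elem rs)
        \<le> clean_count k (phase_set s1) (marked s1) (map elem (r # rs))"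
    proof (cases "?z \<in> marked s1")
      case False
      then have "marked s1 \<subset> cache s1" "finite (cache s1)" "card (cache s1) \<le> k"
        using inv1 1 by (auto simp: pm_inv_def)
      then have "card (marked s1) < k" using psubset_card_mono by (metis le_trans linorder_not_le)
      then show ?thesis using False by simp
    qed (simp add: insert_absorb)
    then have "a * real (clean_count k (phase_set s1) (insert ?z (marked s1)) (map elem rs))
        \<le> a * real (clean_count k (phase_set s1) (marked s1) (map elem (r # rs)))"
      using a_ge_1 by (intro mult_left_mono) auto
    ultimately have "potential ?s' rs \<le> potential s1 (r # rs)"
      unfolding potential_def by simp
    moreover have "pm_inv k ?s'" using inv1 1 by (auto simp: pm_inv_def)
    ultimately show ?thesis unfolding step descends_def using 1 by auto
  next
    case 2
    let ?s' = "s1\<lparr>cache := insert ?z (cache s1), marked := insert ?z (marked s1), misses := Suc (misses s1)\<rparr>"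
    \<comment> \<open>With room in the cache the first phase is still running, so the request is
      clean and \<open>a \<ge> 1\<close> pays for the miss.\<close>
    have S: "phase_set s1 = {}" "marked s1 = cache s1" "chains s1 = []" "finite (cache s1)"
      using inv1 2 by (auto simp: pm_inv_def)
    have "\<rho> (insert ?z (cache s1)) rs \<le> \<rho> (cache s1) (r # rs)" by (rule \<rho>_Cons)
    then have "1 + potential ?s' rs \<le> potential s1 (r # rs)"
      unfolding potential_def using S 2 a_ge_1 by (simp add: algebra_simps)
    moreover have "pm_inv k ?s'" using S 2 by (auto simp: pm_inv_def)
    ultimately show ?thesis unfolding step descends_def using 2 by auto
  next
    case 3
    have "descends s1 r rs (serve_full_miss (harm k) ?z s1)"
      using inv1 3 D order by (intro descends_serve_full_miss[where D = "insert ?z D"]) (auto simp: s1_def)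
    then show ?thesis unfolding step using 3 by simp
  qed
  then show ?thesis unfolding s1_def .
qed

lemma expected_misses_le_potential:
  assumes "pm_inv k s" "cache s \<subseteq> D" "consistent D (latest_pred s) rs"
  shows "finite (set_pmf (pm_run k (harm k) (map fst rs) s)) \<and>
    measure_pmf.expectation (pm_run k (harm k) (map fst rs) s) (\<lambda>s. real (misses s))
      \<le> real (misses s) + potential s rs"
  using assms
proof (induction rs arbitrary: s D)
  case Nil
  then show ?case by (simp add: potential_nonneg)
next
  case (Cons r rs)
  let ?lp = "(latest_pred s)(elem r := snd (fst r))" and ?p = "pm_step k (harm k) (fst r) s"
  have desc: "descends (s\<lparr>latest_pred := ?lp\<rparr>) r rs ?p"
    using Cons.prems by (intro descends_pm_step) auto
  have fin: "finite (set_pmf ?p)" using desc by (simp add: descends_def)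
  have IH: "finite (set_pmf (pm_run k (harm k) (map fst rs) s')) \<and>
    measure_pmf.expectation (pm_run k (harm k) (map fst rs) s') (\<lambda>s. real (misses s))
      \<le> real (misses s') + potential s' rs" if "s' \<in> set_pmf ?p" for s'
  proof (rule Cons.IH)
    show "pm_inv k s'" "cache s' \<subseteq> insert (elem r) D"
      using desc that Cons.prems(2) by (fastforce simp: descends_def)+
    show "consistent (insert (elem r) D) (latest_pred s') rs"
      using desc that Cons.prems(3) by (auto simp: descends_def)
  qed
  have "measure_pmf.expectation (pm_run k (harm k) (map fst (r # rs)) s) (\<lambda>s. real (misses s)) =
      (\<Sum>s'\<in>set_pmf ?p. pmf ?p s' * measure_pmf.expectation (pm_run k (harm k) (map fst rs) s') (\<lambda>s. real (misses s)))"
    using fin IH by (simp add: pmf_expectation_bind[OF fin])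
  also have "\<dots> \<le> (\<Sum>s'\<in>set_pmf ?p. pmf ?p s' * (real (misses s') + potential s' rs))"
    using IH by (intro sum_mono mult_left_mono) auto
  also have "\<dots> = measure_pmf.expectation ?p (\<lambda>s'. real (misses s') + potential s' rs)"
    by (simp add: integral_measure_pmf[OF fin])
  also have "\<dots> \<le> real (misses s) + potential s (r # rs)"
    using desc by (simp add: descends_def)
  finally show ?case using fin IH by simp
qed

lemma expected_misses_le:
  assumes "consistent {} (\<lambda>_. 0) rs"
  shows "measure_pmf.expectation (pm_run k (harm k) (map fst rs) pm_init) (\<lambda>s. real (misses s))
    \<le> a * real (clean_count k {} {} (map elem rs)) + \<rho> {} rs"
  using expected_misses_le_potential[OF pm_inv_init[OF k_pos], of "{}" rs] assms
  by (simp add: pm_init_def potential_def)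

end

lemma one_le_harm: "k \<ge> 1 \<Longrightarrow> (1::real) \<le> harm k"
  using harm_mono[of 1 k, where ?'a = real] by (simp add: harm_def)

section \<open>The two potentials\<close>

text \<open>Before the switch, \<open>n\<close> misses have been paid out of
  \<open>2 * harm k\<close>. The test uses \<open>Suc n\<close> because a chain is lengthened before
  its length is compared with the threshold.\<close>

definition worst_case_pot :: "nat \<Rightarrow> 'a set \<Rightarrow> 'a set \<Rightarrow> 'a request list \<Rightarrow> 'a \<Rightarrow> nat \<Rightarrow> real" where
  "worst_case_pot k U M rs e n =
     (if real (Suc n) \<le> harm k then 2 * harm k - real n else chain_value k M rs e)"

text \<open>At the last deterministic eviction \<open>real (Suc n) \<le> harm k\<close>, so
  \<open>2 * harm k - real n\<close> covers this miss and the value of the random part, which is at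
  most \<open>harm k\<close>.\<close>

lemma chain_potential_worst_case:
  assumes "k \<ge> 1"
  shows "chain_potential k (2 * harm k) (worst_case_pot k) (\<lambda>_ _. 0) (\<lambda>_ _. 0)"
proof
  note H = one_le_harm[OF assms]
  show "0 \<le> worst_case_pot k U M rs e n" for U M rs and e :: 'a and n
    by (auto simp: worst_case_pot_def chain_value_nonneg)
  show "1 + worst_case_pot k (U - {e}) M rs e 1 \<le> 2 * harm k + 0" for U M rs and e :: 'a
    using chain_value_le[of k M rs e] H by (auto simp: worst_case_pot_def)
  show "1 + worst_case_pot k (U - {e}) (insert (elem r) M) rs e (Suc n)
      \<le> worst_case_pot k U M (r # rs) (elem r) n + 0" if "real (Suc n) \<le> harm k" for U M rs r and e :: 'a and n
    using that chain_value_le[of k "insert (elem r) M" rs e] by (auto simp: worst_case_pot_def)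
  show "(\<Sum>e\<in>U. 1 + worst_case_pot k (U - {e}) (insert (elem r) M) rs e (Suc n) - 0)
        \<le> real (card U) * worst_case_pot k U M (r # rs) (elem r) n"
    if "finite U" "U \<noteq> {}" "finite M" "U \<inter> M = {}" "elem r \<notin> U"
      "elem r \<notin> M" "card U = k - card M" "\<not> real (Suc n) \<le> harm k" for U M rs n and r :: "'a request"
    using that sum_chain_value_uniform[of M U "elem r" k rs] by (simp add: worst_case_pot_def)
qed (use assms one_le_harm[OF assms] in \<open>auto simp: worst_case_pot_def\<close>)

text \<open>Counts the lost requests, except for the next request of each element outside the cache \<open>C\<close>:
  that one was charged when the element was evicted.\<close>

primrec lost_budget :: "'a set \<Rightarrow> 'a request list \<Rightarrow> nat" where
  "lost_budget C [] = 0"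
| "lost_budget C (r # rs) = (if snd r \<and> elem r \<in> C then 1 else 0) + lost_budget (insert (elem r) C) rs"

text \<open>Removing \<open>e\<close> from \<open>C\<close> exempts just its next request; from then
  on both sets agree.\<close>

lemma lost_budget_evict:
  "e \<in> C \<Longrightarrow> lost_budget (C - {e}) rs + (if next_lost rs e = Some True then 1 else 0) = lost_budget C rs"
proof (induction rs arbitrary: C)
  case (Cons r rs)
  show ?case
  proof (cases "elem r = e")
    case True
    then show ?thesis using Cons.prems by (simp add: insert_absorb)
  next
    case False
    then have "insert (elem r) (C - {e}) = insert (elem r) C - {e}" by auto
    then show ?thesis using False Cons.IH[of "insert (elem r) C"] Cons.prems by simp
  qed
qed simp

lemma lost_budget_le: "lost_budget C rs \<le> length (filter snd rs)"
  by (induction rs arbitrary: C) (auto intro: le_SucI)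

text \<open>The second summand pays for elements that never return: once evicted, such an element
  leaves the union for good.\<close>

definition error_budget :: "'a set \<Rightarrow> 'a request list \<Rightarrow> real" where
  "error_budget C rs = 2 * real (lost_budget C rs) + real (card (C \<union> elem ` set rs))"

definition error_release :: "'a request list \<Rightarrow> 'a \<Rightarrow> real" where
  "error_release rs e = (case next_lost rs e of None \<Rightarrow> 1 | Some lost \<Rightarrow> if lost then 2 else 0)"

text \<open>A safe chain needs no credit, since each later eviction releases at least 1 itself.
  Otherwise each eviction with a lost return released 2 and cost 1, except that the first miss was
  paid by the clean request; this leaves \<open>n + 1\<close>.\<close>

definition error_pot :: "nat \<Rightarrow> 'a set \<Rightarrow> 'a set \<Rightarrow> 'a request list \<Rightarrow> 'a \<Rightarrow> nat \<Rightarrow> real" where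
  "error_pot k U M rs e n = (if safe U rs e then 0
     else if real (Suc n) \<le> harm k then real n + 1 else chain_value k M rs e)"

lemma next_lost_eq_None_iff: "next_lost rs e = None \<longleftrightarrow> e \<notin> elem ` set rs"
  by (induction rs) auto

lemma error_budget_evict:
  assumes "finite C" "e \<in> C"
  shows "error_budget (C - {e}) rs + error_release rs e \<le> error_budget C rs"
proof (cases "next_lost rs e")
  case None
  then have "C \<union> elem ` set rs = insert e (C - {e} \<union> elem ` set rs)" "e \<notin> C - {e} \<union> elem ` set rs"
    using assms by (auto simp: next_lost_eq_None_iff)
  then have "card (C \<union> elem ` set rs) = Suc (card (C - {e} \<union> elem ` set rs))"
    using assms by (metis card_insert_disjoint finite_Diff finite_UnI finite_imageI finite_set)
  then show ?thesis
    using None lost_budget_evict[OF assms(2), of rs] by (simp add: error_budget_def error_release_def)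
next
  case (Some b)
  then have "e \<in> elem ` set rs" by (metis next_lost_eq_None_iff option.distinct(1))
  then have "C - {e} \<union> elem ` set rs = C \<union> elem ` set rs" by blast
  then show ?thesis
    using Some lost_budget_evict[OF assms(2), of rs] by (auto simp: error_budget_def error_release_def)
qed

lemma chain_potential_error:
  assumes "k \<ge> 1"
  shows "chain_potential k 1 (error_pot k) error_budget error_release"
proof
  note H = one_le_harm[OF assms]
  show "0 \<le> error_pot k U M rs e n" for U M rs and e :: 'a and n
    by (auto simp: error_pot_def chain_value_nonneg)
  show "0 \<le> error_budget C rs" for C and rs :: "'a request list"
    by (simp add: error_budget_def)
  show "error_pot k U' (insert (elem r) M) rs e n \<le> error_pot k U M (r # rs) e n"
    if "e \<noteq> elem r" "U' \<subseteq> U - {elem r}" for U U' M rs r and e :: 'a and n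
    using that safe_Cons[of U r rs e U'] by (auto simp: error_pot_def chain_value_nonneg)
  show "error_budget (insert (elem r) C) rs \<le> error_budget C (r # rs)" for C rs and r :: "'a request"
    by (simp add: error_budget_def)
  show "error_budget (C - {e}) rs + error_release rs e \<le> error_budget C rs"
    if "finite C" "e \<in> C" for C rs and e :: 'a
    using that by (rule error_budget_evict)
  show "1 + error_pot k (U - {e}) M rs e 1 \<le> 1 + error_release rs e"
    if "next_lost rs e \<noteq> Some True \<Longrightarrow> safe (U - {e}) rs e" for U M rs and e :: 'a
    \<comment> \<open>For a lost return the release 2 equals the credit \<open>n + 1\<close> at
      \<open>n = 1\<close>, or exceeds the chain value because \<open>harm k < 2\<close>.\<close>
    using that chain_value_le[of k M rs e]
    by (auto simp: error_pot_def error_release_def split: option.split)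
  \<comment> \<open>When a safe element returns, every candidate is lost next or never requested
    again: its release pays the miss, and the new chain is vacuously safe.\<close>
  have release_ge_1: "1 \<le> error_release rs e" "safe (U - {e}) rs e"
    if "safe U (r # rs) (elem r)" "elem r \<notin> U" "e \<in> U" for U rs r and e :: 'a
    using safe_arrival[OF that(1,2)] that(3)
    by (auto simp: error_release_def safe_def split: option.split)
  have release_nonneg: "0 \<le> error_release rs e" for rs and e :: 'a
    by (simp add: error_release_def split: option.split)
  show "1 + error_pot k (U - {e}) (insert (elem r) M) rs e (Suc n)
      \<le> error_pot k U M (r # rs) (elem r) n + error_release rs e"
    if "e \<in> U" "elem r \<notin> U" "next_lost rs e \<noteq> Some True \<Longrightarrow> safe (U - {e}) rs e"
      "real (Suc n) \<le> harm k" for U M rs r and e :: 'a and n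
  proof (cases "safe U (r # rs) (elem r)")
    case True
    then show ?thesis using release_ge_1[OF True that(2,1)] by (simp add: error_pot_def)
  next
    case False
    \<comment> \<open>If the return of \<open>e\<close> is not lost, the new chain is safe and the
      old credit \<open>n + 1\<close> pays. If it is lost, the release 2 pays the miss and raises
      the credit by one; at the switch \<open>harm k < n + 2\<close> makes this enough for the
      random part.\<close>
    then show ?thesis
      using that(3,4) chain_value_le[of k "insert (elem r) M" rs e] release_nonneg[of rs e]
      by (cases "next_lost rs e = Some True") (auto simp: error_pot_def error_release_def)
  qed
  show "(\<Sum>e\<in>U. 1 + error_pot k (U - {e}) (insert (elem r) M) rs e (Suc n) - error_release rs e)
        \<le> real (card U) * error_pot k U M (r # rs) (elem r) n"
    if U: "finite U" "U \<noteq> {}" "finite M" "U \<inter> M = {}" "elem r \<notin> U"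
      "elem r \<notin> M" "card U = k - card M" "\<not> real (Suc n) \<le> harm k" for U M rs n and r :: "'a request"
  proof (cases "safe U (r # rs) (elem r)")
    case True
    have "(\<Sum>e\<in>U. 1 + error_pot k (U - {e}) (insert (elem r) M) rs e (Suc n) - error_release rs e)
        \<le> (\<Sum>e\<in>U. 0)"
      using release_ge_1[OF True U(5)] by (intro sum_mono) (simp add: error_pot_def)
    then show ?thesis using True by (simp add: error_pot_def)
  next
    case False
    \<comment> \<open>Beyond the switch the chain stays random, so the new credit is 0 or the chain
      value; the releases are dropped.\<close>
    have "(\<Sum>e\<in>U. 1 + error_pot k (U - {e}) (insert (elem r) M) rs e (Suc n) - error_release rs e)
        \<le> (\<Sum>e\<in>U. 1 + chain_value k (insert (elem r) M) rs e)"
      using release_nonneg[of rs] U(8) chain_value_nonneg[of k "insert (elem r) M" rs]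
      by (intro sum_mono) (auto simp: error_pot_def algebra_simps intro: add_nonneg_nonneg)
    also have "\<dots> \<le> real (card U) * harm (k - card M)"
      using U by (intro sum_chain_value_uniform) auto
    finally show ?thesis using False U(8) by (simp add: error_pot_def)
  qed
qed (use assms in auto)

section \<open>From edit distance to lost requests\<close>

definition recorded_pred :: "'a request list \<Rightarrow> 'a \<Rightarrow> nat" where
  "recorded_pred rs = fold (\<lambda>r lp. lp(elem r := snd (fst r))) rs (\<lambda>_. 0)"

lemma consistentI:
  assumes "\<And>us vs. us @ vs = rs \<Longrightarrow> good_ordered (elem ` set us) (recorded_pred us) vs"
  shows "consistent {} (\<lambda>_. 0) rs"
proof -
  have "us @ vs = rs \<Longrightarrow> consistent (elem ` set us) (recorded_pred us) vs" for us vs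
  proof (induction vs arbitrary: us)
    case (Cons r vs)
    have "good_ordered (elem ` set (us @ [r])) (recorded_pred (us @ [r])) vs"
      "consistent (elem ` set (us @ [r])) (recorded_pred (us @ [r])) vs"
      using Cons.prems assms[of "us @ [r]" vs] Cons.IH[of "us @ [r]"] by auto
    then show ?case by (simp add: recorded_pred_def)
  qed simp
  from this[of "[]" rs] show ?thesis by (simp add: recorded_pred_def)
qed

lemma recorded_pred_last:
  assumes "e \<in> elem ` set us"
  shows "\<exists>i<length us. elem (us ! i) = e \<and> (\<forall>j. i < j \<and> j < length us \<longrightarrow> elem (us ! j) \<noteq> e) \<and>
    recorded_pred us e = snd (fst (us ! i))"
  using assms
proof (induction us rule: rev_induct)
  case (snoc r us)
  show ?case
  proof (cases "elem r = e")
    case True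
    then show ?thesis
      by (intro exI[of _ "length us"]) (auto simp: recorded_pred_def)
  next
    case False
    then obtain i where "i < length us" "elem (us ! i) = e"
      "\<forall>j. i < j \<and> j < length us \<longrightarrow> elem (us ! j) \<noteq> e" "recorded_pred us e = snd (fst (us ! i))"
      using snoc by auto
    then show ?thesis using False
      by (intro exI[of _ i]) (auto simp: recorded_pred_def nth_append less_Suc_eq)
  qed
qed simp

lemma next_lost_nth:
  assumes "next_lost rs e = Some b"
  shows "\<exists>j<length rs. elem (rs ! j) = e \<and> snd (rs ! j) = b \<and> (\<forall>i<j. elem (rs ! i) \<noteq> e)"
  using assms
proof (induction rs)
  case (Cons r rs)
  show ?case
  proof (cases "elem r = e")
    case True
    then show ?thesis using Cons.prems by (intro exI[of _ 0]) auto
  next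
    case False
    then obtain j where "j < length rs" "elem (rs ! j) = e" "snd (rs ! j) = b" "\<forall>i<j. elem (rs ! i) \<noteq> e"
      using Cons by auto
    then show ?thesis using False
      by (intro exI[of _ "Suc j"]) (auto simp: nth_Cons split: nat.split)
  qed
qed simp

lemma before_nth:
  "before rs e x \<Longrightarrow> elem (rs ! j) = x \<Longrightarrow> j < length rs \<Longrightarrow> e \<noteq> x \<Longrightarrow> \<exists>i<j. elem (rs ! i) = e"
proof (induction rs arbitrary: j)
  case (Cons r rs)
  show ?case
  proof (cases j)
    case 0
    then show ?thesis using Cons.prems by auto
  next
    case (Suc j')
    then show ?thesis using Cons.prems Cons.IH[of j'] by (cases "elem r = e") auto
  qed
qed simp

section \<open>Numbering the requests of each element\<close>

lemma count_list_take_Suc: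
  "j < length xs \<Longrightarrow> count_list (take (Suc j) xs) y = count_list (take j xs) y + (if xs ! j = y then 1 else 0)"
  by (simp add: take_Suc_conv_app_nth)

lemma count_list_take_mono: "i \<le> j \<Longrightarrow> count_list (take i xs) y \<le> count_list (take j xs) y"
proof (induction j rule: dec_induct)
  case (step j)
  then show ?case using count_list_take_Suc[of j xs y] by (cases "j < length xs") auto
qed simp

lemma inj_on_request_at: "inj_on (request_at \<sigma>) {..<length \<sigma>}"
proof (rule linorder_inj_onI)
  fix i j assume "i < j" "i \<in> {..<length \<sigma>}" "j \<in> {..<length \<sigma>}"
  then show "request_at \<sigma> i \<noteq> request_at \<sigma> j"
    using count_list_take_mono[of "Suc i" j \<sigma> "\<sigma> ! j"] count_list_take_Suc[of j \<sigma> "\<sigma> ! j"]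
    by (auto simp: request_at_def)
qed auto

lemma request_pos_request_at: "i < length \<sigma> \<Longrightarrow> request_pos \<sigma> (request_at \<sigma> i) = i"
  unfolding request_pos_def using inj_on_request_at[of \<sigma>] by (auto simp: inj_on_def)

lemma request_at_next:
  assumes "i < j" "j < length \<sigma>" "\<sigma> ! i = \<sigma> ! j" "\<And>l. i < l \<Longrightarrow> l < j \<Longrightarrow> \<sigma> ! l \<noteq> \<sigma> ! j"
  shows "request_at \<sigma> j = (\<sigma> ! i, Suc (snd (request_at \<sigma> i)))"
proof -
  have "l \<le> j \<Longrightarrow> count_list (take l \<sigma>) (\<sigma> ! j) = count_list (take (Suc i) \<sigma>) (\<sigma> ! j)" if "Suc i \<le> l" for l
    using that
  proof (induction l rule: dec_induct)
    case (step l)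
    then show ?case using assms count_list_take_Suc[of l \<sigma> "\<sigma> ! j"] by simp
  qed simp
  from this[of j] show ?thesis
    using assms count_list_take_Suc[of j \<sigma> "\<sigma> ! j"] by (simp add: request_at_def)
qed

text \<open>Ties the prediction made at \<open>i\<close> to the pair requested next at
  \<open>j\<close>. This pair has a predecessor, so its number is at least 2 and
  \<open>true_order\<close> contains it.\<close>

lemma request_at_next_pair:
  assumes "i < j" "j < length \<sigma>" "\<sigma> ! i = \<sigma> ! j" "\<And>l. i < l \<Longrightarrow> l < j \<Longrightarrow> \<sigma> ! l \<noteq> \<sigma> ! j"
  shows "predicted_time \<sigma> h (request_at \<sigma> j) = h ! i" and "request_at \<sigma> j \<in> set (true_order \<sigma>)"
proof -
  note eq = request_at_next[OF assms]
  have "request_at \<sigma> i = (\<sigma> ! i, snd (request_at \<sigma> i))" by (simp add: request_at_def)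
  then show "predicted_time \<sigma> h (request_at \<sigma> j) = h ! i"
    using eq request_pos_request_at[of i \<sigma>] assms by (simp add: predicted_time_def)
  have "snd (request_at \<sigma> i) > 0"
    using count_list_take_Suc[of i \<sigma> "\<sigma> ! i"] assms by (simp add: request_at_def)
  then have "case request_at \<sigma> j of (e, i) \<Rightarrow> 2 \<le> i" using eq by simp
  then show "request_at \<sigma> j \<in> set (true_order \<sigma>)"
    using assms unfolding true_order_def set_filter by auto
qed

section \<open>Pairs of entries in subsequences and stable sorts\<close>

lemma sorted_wrt_subseq_pair: "sorted_wrt R xs \<Longrightarrow> subseq [x, y] xs \<Longrightarrow> R x y"
proof (induction xs)
  case (Cons z xs)
  then show ?case by (cases "x = z") (auto simp: subseq_singleton_left)
qed simp

lemma subseq_pair_total: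
  "x \<in> set xs \<Longrightarrow> y \<in> set xs \<Longrightarrow> x \<noteq> y \<Longrightarrow> subseq [x, y] xs \<or> subseq [y, x] xs"
proof (induction xs)
  case (Cons z xs)
  then show ?case by (cases "x = z"; cases "y = z") (auto simp: subseq_singleton_left)
qed simp

lemma true_order_subseq_pair:
  assumes "subseq [request_at \<sigma> i, request_at \<sigma> j] (true_order \<sigma>)" "i < length \<sigma>" "j < length \<sigma>"
  shows "i < j"
proof -
  \<comment> \<open>Positions are existentially quantified since the list holds pairs; injectivity
    of \<open>request_at\<close> recovers them.\<close>
  let ?R = "\<lambda>q q'. \<exists>i j. i < j \<and> j < length \<sigma> \<and> q = request_at \<sigma> i \<and> q' = request_at \<sigma> j"
  have "sorted_wrt ?R (map (request_at \<sigma>) [0..<length \<sigma>])"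
    by (auto simp: sorted_wrt_iff_nth_less)
  then have "sorted_wrt ?R (true_order \<sigma>)"
    unfolding true_order_def by (rule sorted_wrt_filter)
  then have "?R (request_at \<sigma> i) (request_at \<sigma> j)"
    using assms(1) by (rule sorted_wrt_subseq_pair)
  then obtain i' j' where "i' < j'" "j' < length \<sigma>"
    "request_at \<sigma> i = request_at \<sigma> i'" "request_at \<sigma> j = request_at \<sigma> j'"
    by blast
  moreover from this have "i = i'" "j = j'"
    using assms inj_onD[OF inj_on_request_at[of \<sigma>]] by simp_all
  ultimately show ?thesis by simp
qed

text \<open>For equal \<open>f\<close>, stability of the outer sort keeps the order of the inner
  sort by \<open>g\<close>.\<close>

lemma sort_key_sort_key_subseq_pair:
  assumes "subseq [x, y] (sort_key f (sort_key g xs))"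
  shows "f x < f y \<or> f x = f y \<and> g x \<le> g y"
proof -
  have f: "f x \<le> f y"
    using sorted_wrt_subseq_pair[OF _ assms, of "\<lambda>u v. f u \<le> f v"] sorted_sort_key[of f "sort_key g xs"]
    by (simp add: sorted_map)
  have g: "subseq [x, y] (sort_key g xs) \<Longrightarrow> g x \<le> g y"
    using sorted_wrt_subseq_pair[of "\<lambda>u v. g u \<le> g v" "sort_key g xs" x y] sorted_sort_key[of g xs]
    by (simp add: sorted_map)
  show ?thesis
  proof (cases "f x = f y")
    case True
    have "subseq (filter (\<lambda>z. f z = f x) [x, y]) (filter (\<lambda>z. f z = f x) (sort_key f (sort_key g xs)))"
      using assms by (rule subseq_filter)
    then have "subseq [x, y] (filter (\<lambda>z. f z = f x) (sort_key g xs))"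
      using True by (simp add: sort_key_stable)
    then have "subseq [x, y] (sort_key g xs)" by (meson subseq_filter_left subseq_order.trans)
    then show ?thesis using True g by blast
  next
    case False
    then show ?thesis using f by simp
  qed
qed

definition annotate :: "'a list \<Rightarrow> nat list \<Rightarrow> ('a \<times> nat) set \<Rightarrow> 'a request list" where
  "annotate \<sigma> h L = map (\<lambda>j. ((\<sigma> ! j, h ! j), request_at \<sigma> j \<in> L)) [0..<length \<sigma>]"

lemma map_annotate:
  assumes "length h = length \<sigma>"
  shows "map fst (annotate \<sigma> h L) = zip \<sigma> h" "map elem (annotate \<sigma> h L) = \<sigma>"
proof -
  show "map fst (annotate \<sigma> h L) = zip \<sigma> h"
    using assms by (intro nth_equalityI) (simp_all add: annotate_def)
  show "map elem (annotate \<sigma> h L) = \<sigma>"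
    by (simp add: annotate_def o_def map_nth)
qed

lemma length_filter_annotate:
  assumes "finite L"
  shows "length (filter snd (annotate \<sigma> h L)) \<le> card L"
proof -
  have "length (filter snd (annotate \<sigma> h L)) = card (set (filter (\<lambda>j. request_at \<sigma> j \<in> L) [0..<length \<sigma>]))"
    by (subst distinct_card) (simp_all add: annotate_def filter_map o_def)
  also have "\<dots> \<le> card L"
    using assms by (intro card_inj_on_le[of "request_at \<sigma>"])
      (auto intro: inj_on_subset[OF inj_on_request_at])
  finally show ?thesis .
qed

text \<open>For the worst-case bound all requests are declared lost, which makes
  \<open>good_ordered\<close> vacuous for any predictions.\<close>

lemma consistent_all_lost: "(\<forall>r\<in>set rs. snd r) \<Longrightarrow> consistent D lp rs"
proof (induction rs arbitrary: D lp)
  case (Cons r rs)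
  have "next_lost rs e \<noteq> Some False" for e
    using Cons.prems next_lost_nth[of rs e False] by (auto dest: nth_mem)
  then show ?case using Cons by (simp add: good_ordered_def)
qed simp

text \<open>The next requests of elements already seen lie in \<open>true_order\<close>, so those
  not lost lie in \<open>zs\<close>. There the true order fixes how two of them are arranged, and
  \<open>pred_order\<close> turns this into an inequality of predictions.\<close>

lemma consistent_annotate:
  assumes "length h = length \<sigma>" "subseq zs (true_order \<sigma>)" "subseq zs (pred_order \<sigma> h)"
  shows "consistent {} (\<lambda>_. 0) (annotate \<sigma> h (set (true_order \<sigma>) - set zs))"
proof (rule consistentI)
  let ?rs = "annotate \<sigma> h (set (true_order \<sigma>) - set zs)"
  fix us vs assume split: "us @ vs = ?rs"
  have len: "length us + length vs = length \<sigma>"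
    using arg_cong[OF split, of length] by (simp add: annotate_def)
  have nth: "?rs ! j = ((\<sigma> ! j, h ! j), request_at \<sigma> j \<in> set (true_order \<sigma>) - set zs)" if "j < length \<sigma>" for j
    using that by (simp add: annotate_def)
  have us: "us ! j = ((\<sigma> ! j, h ! j), request_at \<sigma> j \<in> set (true_order \<sigma>) - set zs)" if "j < length us" for j
    using nth[of j] that len unfolding split[symmetric] by (simp add: nth_append)
  have vs: "vs ! j = ((\<sigma> ! (length us + j), h ! (length us + j)),
      request_at \<sigma> (length us + j) \<in> set (true_order \<sigma>) - set zs)" if "j < length vs" for j
    using nth[of "length us + j"] that len unfolding split[symmetric] by (simp add: nth_append)
  \<comment> \<open>The prediction recorded at the last request of \<open>e\<close> in
    \<open>us\<close> is the predicted time of its first request in \<open>vs\<close>.\<close>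
  have next_good: "\<exists>j<length vs. \<sigma> ! (length us + j) = e \<and> (\<forall>l<j. \<sigma> ! (length us + l) \<noteq> e) \<and>
      request_at \<sigma> (length us + j) \<in> set zs \<and>
      predicted_time \<sigma> h (request_at \<sigma> (length us + j)) = recorded_pred us e"
    if e: "e \<in> elem ` set us" and good: "next_lost vs e = Some False" for e
  proof -
    obtain j where j: "j < length vs" "elem (vs ! j) = e" "\<not> snd (vs ! j)" "\<forall>i<j. elem (vs ! i) \<noteq> e"
      using next_lost_nth[OF good] by auto
    obtain i where i: "i < length us" "elem (us ! i) = e"
      "\<forall>l. i < l \<and> l < length us \<longrightarrow> elem (us ! l) \<noteq> e" "recorded_pred us e = snd (fst (us ! i))"
      using recorded_pred_last[OF e] by auto
    have none: "\<sigma> ! l \<noteq> e" if "i < l" "l < length us + j" for l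
    proof (cases "l < length us")
      case True
      then show ?thesis using i(3) that us[of l] by auto
    next
      case False
      then have m: "l = length us + (l - length us)" "l - length us < j" using that by linarith+
      then have "elem (vs ! (l - length us)) = \<sigma> ! l" using j(1) vs[of "l - length us"] by simp
      then show ?thesis using j(4) m(2) by blast
    qed
    have se: "\<sigma> ! (length us + j) = e" "\<sigma> ! i = e" using j(1,2) vs[of j] i(1,2) us[of i] by simp_all
    have "predicted_time \<sigma> h (request_at \<sigma> (length us + j)) = h ! i"
      "request_at \<sigma> (length us + j) \<in> set (true_order \<sigma>)"
      using none se i(1) j(1) len by (intro request_at_next_pair; simp)+
    then show ?thesis
      using j(1,3) se i(1,4) us[of i] vs[of j] none by (intro exI[of _ j]) simp
  qed
  show "good_ordered (elem ` set us) (recorded_pred us) vs"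
    unfolding good_ordered_def
  proof (intro ballI impI)
    fix e x assume ex: "e \<in> elem ` set us" "x \<in> elem ` set us"
      and *: "e \<noteq> x \<and> next_lost vs e = Some False \<and> next_lost vs x = Some False \<and> before vs e x"
    obtain i where i: "i < length vs" "\<sigma> ! (length us + i) = e" "\<forall>l<i. \<sigma> ! (length us + l) \<noteq> e"
      "request_at \<sigma> (length us + i) \<in> set zs"
      "predicted_time \<sigma> h (request_at \<sigma> (length us + i)) = recorded_pred us e"
      using next_good[OF ex(1)] * by auto
    obtain j where j: "j < length vs" "\<sigma> ! (length us + j) = x"
      "request_at \<sigma> (length us + j) \<in> set zs"
      "predicted_time \<sigma> h (request_at \<sigma> (length us + j)) = recorded_pred us x"
      using next_good[OF ex(2)] * by auto
    \<comment> \<open>Some request of \<open>e\<close> precedes \<open>j\<close>, and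
      \<open>i\<close> is the first one, so \<open>i < j\<close>.\<close>
    obtain i' where "i' < j" "elem (vs ! i') = e"
      using before_nth[of vs e x j] * j(1,2) vs[of j] by auto
    moreover from this have "\<sigma> ! (length us + i') = e" using j(1) vs[of i'] by simp
    then have "\<not> i' < i" using i(3) by blast
    ultimately have "i < j" by linarith
    let ?p = "request_at \<sigma> (length us + i)" and ?q = "request_at \<sigma> (length us + j)"
    have "?p \<noteq> ?q" using i(2) j(2) * by (auto simp: request_at_def)
    moreover have "\<not> subseq [?q, ?p] zs"
    proof
      assume "subseq [?q, ?p] zs"
      then have "subseq [?q, ?p] (true_order \<sigma>)" using assms(2) by (rule subseq_order.trans)
      then have "length us + j < length us + i"
        by (rule true_order_subseq_pair) (use i(1) j(1) len in simp_all)
      then show False using \<open>i < j\<close> by simp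
    qed
    ultimately have "subseq [?p, ?q] zs"
      using subseq_pair_total[OF i(4) j(3)] by blast
    then have "subseq [?p, ?q] (pred_order \<sigma> h)" using assms(3) by (rule subseq_order.trans)
    then have "predicted_time \<sigma> h ?p < predicted_time \<sigma> h ?q \<or>
        predicted_time \<sigma> h ?p = predicted_time \<sigma> h ?q \<and> fst ?p \<le> fst ?q"
      unfolding pred_order_def by (rule sort_key_sort_key_subseq_pair)
    moreover have "fst ?p = e" "fst ?q = x" using i(2) j(2) by (simp_all add: request_at_def)
    ultimately show "lex_less (recorded_pred us) e x"
      using i(5) j(4) * by (auto simp: lex_less_def)
  qed
qed

section \<open>The two bounds on the expected misses\<close>

lemma pm_expected_misses_le_harm:
  assumes "k \<ge> 1" "length h = length \<sigma>"
  shows "pm_expected_misses k (harm k) \<sigma> h \<le> 4 * harm k * real (OPT k \<sigma>)"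
proof -
  have "consistent {} (\<lambda>_. 0) (annotate \<sigma> h (range (request_at \<sigma>)))"
    by (rule consistent_all_lost) (auto simp: annotate_def)
  from chain_potential.expected_misses_le[OF chain_potential_worst_case[OF assms(1)] this]
  have "pm_expected_misses k (harm k) \<sigma> h \<le> 2 * harm k * real (clean_count k {} {} \<sigma>)"
    using map_annotate[OF assms(2)] by (simp add: pm_expected_misses_def)
  also have "\<dots> \<le> 2 * harm k * real (2 * OPT k \<sigma>)"
    using clean_count_le_OPT[OF assms(1), of \<sigma>] by (intro mult_left_mono) (auto simp: harm_nonneg)
  finally show ?thesis by simp
qed

text \<open>At most \<open>2 * OPT k \<sigma>\<close> clean requests with credit 1, one unit for
  each of at most \<open>OPT k \<sigma>\<close> elements, and 2 for each lost request.\<close>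

lemma pm_expected_misses_le_eta_ed:
  assumes "k \<ge> 1" "length h = length \<sigma>"
  shows "pm_expected_misses k (harm k) \<sigma> h \<le> 3 * real (OPT k \<sigma>) + 2 * real (eta_ed \<sigma> h)"
proof -
  have "\<exists>zs. subseq zs (true_order \<sigma>) \<and> subseq zs (pred_order \<sigma> h) \<and>
      length (true_order \<sigma>) \<le> length zs + eta_ed \<sigma> h"
    unfolding eta_ed_def by (rule edit_distance_common_subseq)
  then obtain zs where zs: "subseq zs (true_order \<sigma>)" "subseq zs (pred_order \<sigma> h)"
    "length (true_order \<sigma>) \<le> length zs + eta_ed \<sigma> h"
    by blast
  let ?L = "set (true_order \<sigma>) - set zs"
  let ?rs = "annotate \<sigma> h ?L"
  have "distinct (map (request_at \<sigma>) [0..<length \<sigma>])"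
    using inj_on_request_at[of \<sigma>] by (simp add: distinct_map lessThan_atLeast0)
  then have dist: "distinct (true_order \<sigma>)" unfolding true_order_def by (rule distinct_filter)
  obtain N where N: "zs = nths (true_order \<sigma>) N" using zs(1) by (auto simp: subseq_conv_nths)
  have "distinct zs" unfolding N using dist by (rule distinct_nthsI)
  moreover have "set zs \<subseteq> set (true_order \<sigma>)" unfolding N by (rule set_nths_subset)
  ultimately have "card ?L = length (true_order \<sigma>) - length zs"
    using dist by (simp add: card_Diff_subset distinct_card)
  then have "card ?L \<le> eta_ed \<sigma> h" using zs(3) by linarith
  then have lost: "lost_budget {} ?rs \<le> eta_ed \<sigma> h"
    using lost_budget_le[of "{}" ?rs] length_filter_annotate[of ?L \<sigma> h] by simp
  have "elem ` set ?rs = set \<sigma>" by (metis list.set_map map_annotate(2)[OF assms(2)])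
  then have "error_budget {} ?rs \<le> 2 * real (eta_ed \<sigma> h) + real (OPT k \<sigma>)"
    using lost card_set_le_OPT[OF assms(1), of \<sigma>] by (simp add: error_budget_def)
  then show ?thesis
    using chain_potential.expected_misses_le[OF chain_potential_error[OF assms(1)]
        consistent_annotate[OF assms(2) zs(1,2)]] clean_count_le_OPT[OF assms(1), of \<sigma>]
    by (simp add: pm_expected_misses_def map_annotate[OF assms(2)])
qed

theorem theorem4:
  fixes \<sigma> :: "'a::linorder list" and h :: "nat list" and k :: nat
  assumes "k \<ge> 1"
    and "length h = length \<sigma>"
    and "\<forall>x \<in> set h. x \<ge> 1"
  shows "pm_expected_misses k (harm k) \<sigma> h / real (OPT k \<sigma>)
    \<le> min (3 + 2 * (real (eta_ed \<sigma> h) / real (OPT k \<sigma>))) (4 * harm k)"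
proof (cases "OPT k \<sigma> = 0")
  case True
  \<comment> \<open>Division by zero yields 0, so the left side vanishes and the right side is
    nonnegative.\<close>
  then show ?thesis by (simp add: harm_nonneg)
next
  case False
  then show ?thesis
    using pm_expected_misses_le_harm[OF assms(1,2)] pm_expected_misses_le_eta_ed[OF assms(1,2)]
    by (simp add: field_simps)
qed

end
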